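(* Let $m,k$ be positive integers and $\epsilon\in\{+,-\}$. Let $Q$ be the non-singular quadratic form over $\mathbb{F}_{2^k}$ whose isometry group is $\mathrm{O}^{\epsilon}(2m,2^k)$, and let $\mathrm{Sp}(2m,2^k)$ be the isometry group of the bilinear form $\beta_Q$ associated to $Q$, so that $\mathrm{O}^{\epsilon}(2m,2^k)\leqslant\mathrm{Sp}(2m,2^k)$. Two semisimple elements $X,Y\in\mathrm{O}^{\epsilon}(2m,2^k)$ are conjugate in $\mathrm{O}^{\epsilon}(2m,2^k)$ if, and only if, they are conjugate in $\mathrm{Sp}(2m,2^k)$, so if, and only if, they are similar (conjugate in $\mathrm{GL}(2m,2^k)$). Moreover, if $X+1$ is non-singular, then $C_{\mathrm{O}^{\epsilon}(2m,2^k)}(X)=C_{\mathrm{Sp}(2m,2^k)}(X)$.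
   Context: A quadratic form $Q$ on $V=\mathbb{F}_{2^k}^{2m}$ is non-singular if $\beta_Q(u,v)=Q(u+v)-Q(u)-Q(v)$ is non-degenerate; it has plus type ($\epsilon=+$) if a maximal totally singular subspace has dimension $m$, and minus type ($\epsilon=-$) if it has dimension $m-1$. The isometry group of $Q$ is $\{X\in\mathrm{GL}(V): Q(vX)=Q(v)\ \forall v\}$; similarly for $\beta_Q$. Semisimple means of odd order. $C_H(X)$ denotes the centralizer of $X$ in $H$. *)

theory Defs
  imports "HOL-Analysis.Cartesian_Space" "HOL-Algebra.Multiplicative_Group"
begin

definition polar_form :: "('a::field ^ 'n \<Rightarrow> 'a) \<Rightarrow> 'a ^ 'n \<Rightarrow> 'a ^ 'n \<Rightarrow> 'a" where
  "polar_form Q u v = Q (u + v) - Q u - Q v"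

definition bilinear_form :: "('a::field ^ 'n \<Rightarrow> 'a ^ 'n \<Rightarrow> 'a) \<Rightarrow> bool" where
  "bilinear_form B \<longleftrightarrow>
     (\<forall>u. Vector_Spaces.linear (*s) (*) (\<lambda>v. B u v)) \<and>
     (\<forall>v. Vector_Spaces.linear (*s) (*) (\<lambda>u. B u v))"

definition quadratic_form :: "('a::field ^ 'n \<Rightarrow> 'a) \<Rightarrow> bool" where
  "quadratic_form Q \<longleftrightarrow>
     (\<forall>a v. Q (a *s v) = a\<^sup>2 * Q v) \<and> bilinear_form (polar_form Q)"

text \<open>One-sided non-degeneracy suffices, as it is only used for symmetric forms.\<close>

definition nondegenerate :: "('a::field ^ 'n \<Rightarrow> 'a ^ 'n \<Rightarrow> 'a) \<Rightarrow> bool" where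
  "nondegenerate B \<longleftrightarrow> (\<forall>u. (\<forall>v. B u v = 0) \<longrightarrow> u = 0)"

definition nonsingular_form :: "('a::field ^ 'n \<Rightarrow> 'a) \<Rightarrow> bool" where
  "nonsingular_form Q \<longleftrightarrow> nondegenerate (polar_form Q)"

definition totally_singular :: "('a::field ^ 'n \<Rightarrow> 'a) \<Rightarrow> ('a ^ 'n) set \<Rightarrow> bool" where
  "totally_singular Q W \<longleftrightarrow> vec.subspace W \<and> (\<forall>w\<in>W. Q w = 0)"

definition maximal_totally_singular ::
    "('a::field ^ 'n \<Rightarrow> 'a) \<Rightarrow> ('a ^ 'n) set \<Rightarrow> bool" where
  "maximal_totally_singular Q W \<longleftrightarrow>
     totally_singular Q W \<and> (\<forall>W'. totally_singular Q W' \<longrightarrow> W \<subseteq> W' \<longrightarrow> W' = W)"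

datatype sign = Plus | Minus

text \<open>The type is a notion for forms on a space of dimension \<open>2 * m\<close> with \<open>m > 0\<close>. By Witt's
  theorem all maximal totally singular subspaces of a non-singular form have the same
  dimension.\<close>

definition has_type :: "nat \<Rightarrow> sign \<Rightarrow> ('a::field ^ 'n \<Rightarrow> 'a) \<Rightarrow> bool" where
  "has_type m \<epsilon> Q \<longleftrightarrow>
     (\<exists>W. maximal_totally_singular Q W \<and>
        vec.dim W = (case \<epsilon> of Plus \<Rightarrow> m | Minus \<Rightarrow> m - 1))"

definition GL :: "('a::field ^ 'n ^ 'n) monoid" where
  "GL = \<lparr>carrier = {X. invertible X}, mult = (**), one = mat 1\<rparr>"

text \<open>Matrices act on row vectors from the right.\<close>

definition Oform :: "('a::field ^ 'n \<Rightarrow> 'a) \<Rightarrow> ('a ^ 'n ^ 'n) monoid" where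
  "Oform Q = GL\<lparr>carrier := {X \<in> carrier GL. \<forall>v. Q (v v* X) = Q v}\<rparr>"

definition Spform :: "('a::field ^ 'n \<Rightarrow> 'a ^ 'n \<Rightarrow> 'a) \<Rightarrow> ('a ^ 'n ^ 'n) monoid" where
  "Spform B = GL\<lparr>carrier := {X \<in> carrier GL. \<forall>u v. B (u v* X) (v v* X) = B u v}\<rparr>"

text \<open>In characteristic two, an element of the finite group \<open>GL\<close> is semisimple if and only if
  its order is odd.\<close>

definition semisimple :: "'a::field ^ 'n ^ 'n \<Rightarrow> bool" where
  "semisimple X \<longleftrightarrow> odd (group.ord GL X)"

definition conjugate_in :: "('g, 'b) monoid_scheme \<Rightarrow> 'g \<Rightarrow> 'g \<Rightarrow> bool" where
  "conjugate_in H x y \<longleftrightarrow>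
     (\<exists>h\<in>carrier H. y = inv\<^bsub>H\<^esub> h \<otimes>\<^bsub>H\<^esub> x \<otimes>\<^bsub>H\<^esub> h)"

definition centralizer :: "('g, 'b) monoid_scheme \<Rightarrow> 'g \<Rightarrow> 'g set" where
  "centralizer H x = {h \<in> carrier H. h \<otimes>\<^bsub>H\<^esub> x = x \<otimes>\<^bsub>H\<^esub> h}"

lemma group_GL: "group (GL :: ('a::field ^ 'n ^ 'n) monoid)"
proof (rule groupI)
  fix X :: "'a ^ 'n ^ 'n" assume "X \<in> carrier GL"
  then obtain Y where "X ** Y = mat 1" "Y ** X = mat 1"
    by (auto simp: GL_def invertible_def)
  then show "\<exists>Y\<in>carrier GL. Y \<otimes>\<^bsub>GL\<^esub> X = \<one>\<^bsub>GL\<^esub>"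
    by (auto simp: GL_def invertible_def)
qed (auto simp: GL_def matrix_mul_assoc invertible_mult invertible_def[of "mat 1"])

lemma subgroup_Oform:
  fixes Q :: "'a::field ^ 'n \<Rightarrow> 'a"
  shows "subgroup (carrier (Oform Q)) GL"
proof -
  interpret group "GL :: ('a ^ 'n ^ 'n) monoid" by (rule group_GL)
  show ?thesis
  proof (rule subgroupI)
    show "carrier (Oform Q) \<noteq> {}"
      using one_closed by (force simp: Oform_def GL_def)
  next
    fix X assume X: "X \<in> carrier (Oform Q)"
    then have XG: "X \<in> carrier GL" by (simp add: Oform_def)
    have "inv\<^bsub>GL\<^esub> X ** X = mat 1" using l_inv[OF XG] by (simp add: GL_def)
    then have "Q (v v* inv\<^bsub>GL\<^esub> X) = Q v" for v
      using X by (simp add: Oform_def) (metis vector_matrix_mul_assoc vector_matrix_mul_rid)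
    then show "inv\<^bsub>GL\<^esub> X \<in> carrier (Oform Q)"
      using inv_closed[OF XG] by (simp add: Oform_def)
  next
    fix X Y assume "X \<in> carrier (Oform Q)" "Y \<in> carrier (Oform Q)"
    then show "X \<otimes>\<^bsub>GL\<^esub> Y \<in> carrier (Oform Q)"
      using m_closed by (simp add: Oform_def GL_def flip: vector_matrix_mul_assoc)
  qed (auto simp: Oform_def)
qed

lemma subgroup_Spform:
  fixes B :: "'a::field ^ 'n \<Rightarrow> 'a ^ 'n \<Rightarrow> 'a"
  shows "subgroup (carrier (Spform B)) GL"
proof -
  interpret group "GL :: ('a ^ 'n ^ 'n) monoid" by (rule group_GL)
  show ?thesis
  proof (rule subgroupI)
    show "carrier (Spform B) \<noteq> {}"
      using one_closed by (force simp: Spform_def GL_def)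
  next
    fix X assume X: "X \<in> carrier (Spform B)"
    then have XG: "X \<in> carrier GL" by (simp add: Spform_def)
    have "inv\<^bsub>GL\<^esub> X ** X = mat 1" using l_inv[OF XG] by (simp add: GL_def)
    then have "B (u v* inv\<^bsub>GL\<^esub> X) (v v* inv\<^bsub>GL\<^esub> X) = B u v" for u v
      using X by (simp add: Spform_def) (metis vector_matrix_mul_assoc vector_matrix_mul_rid)
    then show "inv\<^bsub>GL\<^esub> X \<in> carrier (Spform B)"
      using inv_closed[OF XG] by (simp add: Spform_def)
  next
    fix X Y assume "X \<in> carrier (Spform B)" "Y \<in> carrier (Spform B)"
    then show "X \<otimes>\<^bsub>GL\<^esub> Y \<in> carrier (Spform B)"
      using m_closed by (simp add: Spform_def GL_def flip: vector_matrix_mul_assoc)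
  qed (auto simp: Spform_def)
qed

end

theory Submission
  imports Defs "HOL-Number_Theory.Residues"
begin

text \<open>Let \<open>h\<close> conjugate \<open>X\<close> to \<open>Y\<close> in the general linear group. The form \<open>Q'(v) = Q (v h)\<close> is
  \<open>X\<close>-invariant, and it suffices to carry \<open>Q\<close> to \<open>Q'\<close> by an element \<open>L\<close> commuting with \<open>X\<close>, since
  then \<open>L\<^sup>-\<^sup>1 h\<close> is an isometry of \<open>Q\<close> conjugating \<open>X\<close> to \<open>Y\<close>. Write \<open>*\<close> for the adjoint with
  respect to the polar form \<open>\<beta>\<close>, so that the polar form of \<open>Q'\<close> is \<open>\<beta>(u S, v)\<close> with \<open>S = h h\<^sup>*\<close>.

  On the image of \<open>X + 1\<close> the equation \<open>g g\<^sup>* = S\<close> is solved by some \<open>g\<close> commuting with \<open>X\<close>: even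
  powers of \<open>S\<close> are norms, so \<open>S\<close> may be assumed to have order a power of two, and for \<open>S = 1 + N\<close>
  with \<open>N\<close> nilpotent \<open>1 + z N\<close> with \<open>z + z\<^sup>* = 1\<close> is a first step of a Newton iteration. There an
  invariant quadratic form is determined by its polar form, because the difference of two such
  forms is additive and \<open>X\<close>-invariant. On the fixed space of \<open>X\<close>, which is orthogonal to that
  image, the two forms have the same Gauss sum and are therefore isometric.\<close>

section \<open>Norm equations in rings with involution\<close>

text \<open>A predicate instead of an equation lets commutation of compound expressions, here mostly
  sums of powers of \<open>X\<close>, follow by introduction rules along their syntax.\<close>

definition commute :: "'r::ring_1 \<Rightarrow> 'r \<Rightarrow> bool" where
  "commute x y \<longleftrightarrow> x * y = y * x"

lemma commute_sym: "commute x y \<Longrightarrow> commute y x"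
  by (simp add: commute_def)

lemma commute_refl [simp]: "commute x x"
  by (simp add: commute_def)

lemma commute_one [simp]: "commute x 1" "commute 1 x"
  by (simp_all add: commute_def)

lemma commute_add_right: "commute x y \<Longrightarrow> commute x z \<Longrightarrow> commute x (y + z)"
  by (simp add: commute_def distrib_left distrib_right)

lemma commute_mult_right: "commute x y \<Longrightarrow> commute x z \<Longrightarrow> commute x (y * z)"
proof -
  assume "commute x y" "commute x z"
  then have "x * y = y * x" "x * z = z * x" by (simp_all add: commute_def)
  then have "x * (y * z) = (y * z) * x" by (simp flip: mult.assoc) (simp add: mult.assoc)
  then show ?thesis by (simp add: commute_def)
qed

lemma commute_power_right: "commute x y \<Longrightarrow> commute x (y ^ n)"
  by (induction n) (auto simp: commute_mult_right)

lemma commute_sum_right: "(\<And>i. i \<in> I \<Longrightarrow> commute x (y i)) \<Longrightarrow> commute x (sum y I)"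
  unfolding commute_def by (simp add: sum_distrib_left sum_distrib_right)

lemma commute_add_left: "commute y x \<Longrightarrow> commute z x \<Longrightarrow> commute (y + z) x"
  by (intro commute_sym[OF commute_add_right]) (rule commute_sym, assumption)+

lemma commute_mult_left: "commute y x \<Longrightarrow> commute z x \<Longrightarrow> commute (y * z) x"
  by (intro commute_sym[OF commute_mult_right]) (rule commute_sym, assumption)+

lemma commute_power_left: "commute y x \<Longrightarrow> commute (y ^ n) x"
  by (intro commute_sym[OF commute_power_right]) (rule commute_sym, assumption)+

lemma commute_sum_left: "(\<And>i. i \<in> I \<Longrightarrow> commute (y i) x) \<Longrightarrow> commute (sum y I) x"
  unfolding commute_def by (simp add: sum_distrib_left sum_distrib_right)

lemmas commute_intros = commute_refl commute_one commute_add_right commute_mult_right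
  commute_power_right commute_sum_right commute_add_left commute_mult_left commute_power_left
  commute_sum_left

lemma commute_power_mult: "commute x y \<Longrightarrow> (x * y) ^ n = x ^ n * y ^ n"
proof (induction n)
  case (Suc n)
  have "commute (x ^ n) y"
    using Suc.prems by (rule commute_power_left)
  then have "y * (x ^ n * y ^ n) = x ^ n * (y * y ^ n)"
    by (simp add: commute_def flip: mult.assoc)
  then show ?case
    using Suc by (simp add: mult.assoc)
qed simp

lemma left_right_inverse_unique:
  fixes a b c :: "'r::ring_1"
  assumes "b * c = 1" "a * b = 1"
  shows "c = a"
proof -
  have "c = a * b * c" using assms by simp
  also have "\<dots> = a" by (simp add: mult.assoc assms(1))
  finally show ?thesis .
qed

lemma nat_odd_part: "n > 0 \<Longrightarrow> \<exists>k d. n = 2 ^ k * d \<and> odd d" for n :: nat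
proof (induction n rule: less_induct)
  case (less n)
  show ?case
  proof (cases "odd n")
    case True
    then show ?thesis by (intro exI[of _ 0] exI[of _ n]) simp
  next
    case False
    then have b: "n = 2 * (n div 2)" by simp
    then have "0 < n div 2" "n div 2 < n" using less.prems by linarith+
    then obtain k d where "n div 2 = 2 ^ k * d" "odd d" using less.IH by meson
    then show ?thesis using b by (intro exI[of _ "Suc k"] exI[of _ d]) simp
  qed
qed

text \<open>By pigeonhole two powers of \<open>x\<close> agree, and a power of the right inverse
  cancels the smaller one. For the element \<open>S\<close> of the norm equation this supplies the
  exponent \<open>n\<close>.\<close>

lemma finite_unit_power_eq_1:
  fixes x y :: "'r::{ring_1,finite}"
  assumes "x * y = 1"
  shows "\<exists>n>0. x ^ n = 1"
proof -
  have "\<not> inj (\<lambda>n::nat. x ^ n)"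
    using finite_imageD[of "\<lambda>n::nat. x ^ n" UNIV] by auto
  then obtain a b where ab: "a < b" "x ^ a = x ^ b"
    unfolding inj_def by (metis linorder_neqE_nat)
  have yx: "x ^ k * y ^ k = 1" for k
  proof (induction k)
    case (Suc k)
    have "x ^ Suc k * y ^ Suc k = x * (x ^ k * y ^ k) * y"
      by (subst power_Suc2[of y]) (simp add: mult.assoc)
    then show ?case using Suc assms by simp
  qed simp
  have "x ^ (b - a) * x ^ a = x ^ a"
    using ab by (metis le_add_diff_inverse2 less_imp_le power_add)
  then have "x ^ (b - a) * x ^ a * y ^ a = x ^ a * y ^ a" by simp
  then have "x ^ (b - a) = 1" by (simp add: yx mult.assoc)
  then show ?thesis using ab by (intro exI[of _ "b - a"]) auto
qed

text \<open>The model is the matrix ring of a symplectic space in characteristic two with the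
  adjoint as \<open>star\<close>. Commutativity is not assumed; \<open>g * star g\<close> plays the
  role of a norm.\<close>

locale char2_star_ring =
  fixes star :: "'r::ring_1 \<Rightarrow> 'r"
  assumes star_mult: "star (x * y) = star y * star x"
    and star_add: "star (x + y) = star x + star y"
    and star_star [simp]: "star (star x) = x"
    and one_plus_one: "(1::'r) + 1 = 0"
begin

lemma double_zero: "x + x = (0::'r)"
  using distrib_left[of x 1 1] by (simp only: one_plus_one mult_1_right mult_zero_right)

lemma double_zero_left: "x + (x + y) = (y::'r)"
  by (simp add: double_zero flip: add.assoc)

lemma add_swap: "x + y = z \<Longrightarrow> y = x + (z::'r)"
  using double_zero_left[of x y] by simp

lemma even_sum_zero:
  fixes n :: nat
  shows "even n \<Longrightarrow> (\<Sum>i=1..n. x) = (0::'r)"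
proof (elim evenE)
  fix b assume "n = 2 * b"
  then have "n = b + b" by simp
  then show ?thesis
    by (simp only: sum_constant card_atLeastAtMost of_nat_add distrib_right double_zero
      diff_Suc_1 Suc_eq_plus1[symmetric] mult_zero_left)
qed

lemma star_one [simp]: "star 1 = 1"
  using star_mult[of "star 1" 1] by simp

lemma star_zero [simp]: "star 0 = 0"
  using star_add[of 0 0] by simp

lemma star_power: "star (x ^ n) = star x ^ n"
  by (induction n) (auto simp: star_mult power_commutes)

lemma star_sum: "star (sum x I) = (\<Sum>i\<in>I. star (x i))"
  by (induction I rule: infinite_finite_induct) (auto simp: star_add)

lemma one_add_power2: "(1 + x) ^ (2 ^ k) = 1 + x ^ (2 ^ k)" for x :: 'r
proof (induction k)
  case (Suc k)
  have sq: "(1 + y) * (1 + y) = 1 + y * y" for y :: 'r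
    by (simp add: algebra_simps double_zero double_zero_left)
  show ?case
    by (simp add: mult_2 power_add Suc sq)
qed simp

text \<open>For \<open>N = S + 1\<close> the trial solution \<open>g = 1 + z * N\<close> has norm
  \<open>S\<close> up to the error \<open>z * star z * N * N\<close>. Dividing \<open>S\<close> by
  this norm from both sides leaves \<open>S'\<close> with \<open>S' + 1\<close> a multiple of
  \<open>N * N\<close>, which halves the exponent of nilpotency. The condition on
  \<open>z + star z\<close> is imposed only on multiples of \<open>S + 1\<close>, because in the
  application \<open>z + star z\<close> is a projection and not 1.\<close>

lemma norm_eq_unipotent:
  assumes "commute S z" "commute S (star z)" "commute S X" "star S = S"
    and "(S + 1) ^ (2 ^ k) = 0" "(z + star z) * (S + 1) = S + 1"
    and "commute z (star z)" "commute X z" "commute X (star z)"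
  shows "\<exists>g. g * star g = S \<and> commute g X"
  using assms
proof (induction k arbitrary: S)
  case 0
  then have "S = 1" using add_swap[of 1 S 0] by (simp add: add.commute)
  then show ?case by (intro exI[of _ 1]) simp
next
  case (Suc k)
  define N where "N = S + 1"
  define z' where "z' = star z"
  note S [simp] = Suc.prems(1-3)
  have com [simp]: "commute z z'" "commute z' z" "commute z S" "commute z' S" "commute X S"
    "commute X z" "commute z X" "commute X z'" "commute z' X" "commute S z'"
    using Suc.prems by (auto simp: z'_def commute_sym)
  have SN: "S = 1 + N"
    by (simp add: N_def add.commute double_zero_left)
  have comN [simp]: "commute N z" "commute N z'" "commute N X" "commute N S"
    "commute z N" "commute z' N" "commute X N" "commute S N"
    unfolding N_def by (intro commute_intros; simp)+
  have starN: "star N = N" using Suc.prems(4) by (simp add: N_def star_add)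
  define g where "g = 1 + z * N"
  define m :: nat where "m = 2 ^ Suc k"
  have Nm: "N ^ m = 0" using Suc.prems(5) by (simp add: N_def m_def)
  have "(z * N) ^ m = 0"
    using Nm by (simp add: commute_power_mult)
  then have gm: "g ^ m = 1"
    using one_add_power2[of "z * N" "Suc k"] by (simp add: g_def m_def)
  \<comment> \<open>The inverse of \<open>g\<close>, written as a power of \<open>g\<close>, so that
    it commutes with whatever commutes with \<open>z\<close> and \<open>N\<close>.\<close>
  define G where "G = g ^ (m - 1)"
  have "m > 0" by (simp add: m_def)
  then have gG: "g * G = 1" "G * g = 1"
    using gm by (simp_all add: G_def flip: power_Suc power_Suc2)
  have sg: "star g = 1 + z' * N"
    using comN by (simp add: g_def star_add star_mult starN z'_def commute_def)
  have sG: "star G = (1 + z' * N) ^ (m - 1)"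
    by (simp add: G_def star_power sg)
  have comg [simp]: "commute x G" "commute x (star G)" 
    if "commute x z" "commute x z'" "commute x N" for x
    unfolding sG unfolding G_def g_def using that
    by (intro commute_intros; simp)+
  have comG: "commute G x" "commute (star G) x" 
    if "commute x z" "commute x z'" "commute x N" for x
    using comg[OF that] by (auto simp: commute_sym)
  have norm_g: "g * star g = S + z * z' * (N * N)"
  proof -
    have "N * z' = z' * N" using comN by (simp add: commute_def)
    then have "z * (N * (z' * N)) = z * (z' * (N * N))" by (simp flip: mult.assoc)
    moreover have "z * N + z' * N = N"
      using Suc.prems(6) by (simp add: N_def z'_def distrib_right)
    ultimately show ?thesis
      unfolding sg unfolding g_def SN by (simp add: algebra_simps)
  qed
  define S' where "S' = G * S * star G"
  have sGg: "star g * star G = 1" "star G * star g = 1"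
    using star_mult[of G g] star_mult[of g G] by (simp_all add: gG)
  define w where "w = G * (z * z') * star G"
  have S'1: "S' + 1 = w * (N * N)"
  proof -
    have "G * (g * star g) * star G = 1"
    proof -
      have "G * (g * star g) * star G = (G * g) * (star g * star G)" by (simp only: mult.assoc)
      then show ?thesis by (simp add: gG sGg)
    qed
    then have "S' + 1 = G * (S + g * star g) * star G"
      by (simp add: S'_def algebra_simps)
    also have "\<dots> = G * (z * z' * (N * N)) * star G"
      by (simp add: norm_g double_zero_left)
    also have "\<dots> = w * (N * N)"
    proof -
      have "commute (N * N) (star G)" by (intro commute_mult_left comg(2)) simp_all
      then show ?thesis by (simp add: w_def commute_def mult.assoc)
    qed
    finally show ?thesis .
  qed
  have comw: "commute N w" unfolding w_def by (intro commute_intros; simp)+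
  have "(S' + 1) ^ (2 ^ k) = w ^ (2 ^ k) * N ^ m"
  proof -
    have "commute w (N * N)" using comw by (intro commute_intros; simp add: commute_sym)+
    then have "(S' + 1) ^ (2 ^ k) = w ^ (2 ^ k) * (N * N) ^ (2 ^ k)"
      by (simp add: S'1 commute_power_mult)
    moreover have "(N * N) ^ (2 ^ k) = N ^ m" by (simp add: m_def power_mult power2_eq_square)
    ultimately show ?thesis by simp
  qed
  then have "(S' + 1) ^ (2 ^ k) = 0" by (simp add: Nm)
  \<comment> \<open>The factor \<open>N\<close> is moved to the front of \<open>S' + 1\<close>,
    where it absorbs \<open>z + star z\<close>.\<close>
  moreover have "(z + star z) * (S' + 1) = S' + 1"
  proof -
    have "(z + z') * N = N"
      using Suc.prems(6) by (simp add: N_def z'_def)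
    moreover have "S' + 1 = N * (N * w)"
    proof -
      have "w * (N * N) = (N * N) * w"
        using commute_mult_left[OF comw comw] by (simp add: commute_def)
      then show ?thesis by (simp add: S'1 mult.assoc)
    qed
    ultimately show ?thesis by (simp add: z'_def flip: mult.assoc)
  qed
  moreover have "star S' = S'"
    by (simp add: S'_def star_mult Suc.prems(4) mult.assoc)
  moreover have "commute S' z" "commute S' (star z)" "commute S' X"
    unfolding S'_def z'_def[symmetric] by (intro commute_intros comG; simp)+
  ultimately obtain g1 where g1: "g1 * star g1 = S'" "commute g1 X"
    using Suc.IH[of S'] Suc.prems(7-9) by blast
  have "commute g X"
    unfolding g_def by (intro commute_intros; simp)+
  moreover have "(g * g1) * star (g * g1) = S"
  proof -
    have "(g * g1) * star (g * g1) = g * S' * star g"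
      by (simp add: star_mult mult.assoc flip: g1(1))
    also have "\<dots> = (g * G) * S * (star G * star g)"
      by (simp add: S'_def mult.assoc)
    finally show ?thesis by (simp add: gG sGg)
  qed
  moreover have "commute (g * g1) X" if "commute g X"
    using that g1(2) by (rule commute_mult_left)
  ultimately have "(g * g1) * star (g * g1) = S \<and> commute (g * g1) X" by simp
  then show ?case by (rule exI)
qed

text \<open>With \<open>X\<close> an isometry of order \<open>2 s + 1\<close>, the element \<open>z = X + \<dots> + X\<^sup>s\<close> satisfies
  \<open>z + star z = X + \<dots> + X\<^sup>2\<^sup>s\<close>, which is the projection onto the image of \<open>X + 1\<close>.
  For \<open>n = 2\<^sup>k d\<close> with \<open>d\<close> odd, dividing \<open>S\<close> by the square \<open>S\<^sup>d\<^sup>+\<^sup>1\<close> leaves a unipotent element.\<close>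

lemma norm_eq_isometry:
  assumes X: "X * star X = 1" "X ^ (2 * s + 1) = 1"
    and S: "commute S X" "star S = S" "S ^ n = 1" "n > 0"
  defines "f \<equiv> \<Sum>i=1..2 * s. X ^ i"
  shows "\<exists>g y. g * star g = S * f + (1 + f) \<and> g * y = 1 \<and> commute g X"
    and "f * f = f" and "X * (1 + f) = 1 + f" and "star f = f"
proof -
  define z where "z = (\<Sum>i=1..s. X ^ i)"
  define e where "e = 1 + f"
  have XX: "star X = X ^ (2 * s)"
  proof -
    have "star X = X ^ (2 * s + 1) * star X" using X by simp
    also have "\<dots> = X ^ (2 * s) * (X * star X)" by (simp only: mult.assoc power_add power_one_right)
    finally show ?thesis using X by simp
  qed
  have starXi: "star (X ^ i) = X ^ (2 * s + 1 - i)" if "i \<le> 2 * s + 1" for i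
  proof -
    have "X ^ i * star (X ^ i) = 1"
    proof (induction i)
      case (Suc i)
      have "X ^ Suc i * star (X ^ Suc i) = X ^ i * (X * star X) * star (X ^ i)"
        by (simp only: power_Suc2 star_mult mult.assoc)
      then show ?case using Suc X by simp
    qed simp
    moreover have "X ^ (2 * s + 1 - i) * X ^ i = 1"
      using X that by (simp flip: power_add)
    ultimately show ?thesis by (rule left_right_inverse_unique)
  qed
  \<comment> \<open>As \<open>star X\<close> inverts \<open>X\<close> and the exponent
    \<open>2 * s + 1\<close> kills \<open>X\<close>, the involution reflects the exponents from 1 to
    \<open>s\<close> onto those from \<open>s + 1\<close> to \<open>2 * s\<close>.\<close>
  have star_z: "star z = (\<Sum>i = s + 1..2 * s. X ^ i)"
    unfolding z_def star_sum
    by (rule sum.reindex_bij_witness[of _ "\<lambda>i. 2 * s + 1 - i" "\<lambda>i. 2 * s + 1 - i"])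
      (auto simp: starXi)
  have zz: "z + star z = f"
    unfolding star_z unfolding z_def f_def mult_2
    by (rule sum.ub_add_nat[symmetric]) simp
  show star_f: "star f = f"
    using star_add[of z "star z"] by (simp add: zz add.commute)
  \<comment> \<open>The sum over all \<open>2 * s + 1\<close> powers of \<open>X\<close>. This
    number is odd, hence 1 in the ring, so \<open>e\<close> is the averaging idempotent onto the
    fixed space of \<open>X\<close>.\<close>
  have e_sum: "e = (\<Sum>i\<le>2 * s. X ^ i)"
  proof -
    have "{..2 * s} = insert 0 {1..2 * s}" by auto
    then show ?thesis by (simp add: e_def f_def)
  qed
  have Xe: "X * e = e"
  proof -
    have "X * e = (\<Sum>i\<le>2 * s. X ^ Suc i)" by (simp add: e_sum sum_distrib_left)
    also have "\<dots> + 1 = (\<Sum>i\<le>Suc (2 * s). X ^ i)" 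
      by (subst sum.atMost_Suc_shift) simp
    also have "\<dots> = e + 1" using X by (simp add: e_sum)
    finally show ?thesis by simp
  qed
  then show "X * (1 + f) = 1 + f" by (simp only: e_def)
  have Xie: "X ^ i * e = e" for i
    by (induction i) (auto simp: Xe mult.assoc)
  \<comment> \<open>Each of the \<open>2 * s\<close> summands of \<open>f\<close> sends
    \<open>e\<close> to \<open>e\<close>, and an even number of copies cancels.\<close>
  have fe: "f * e = 0"
    by (simp only: f_def sum_distrib_right Xie even_sum_zero dvd_triv_left)
  then have "f + f * f = 0" by (simp add: e_def distrib_left)
  then show ff: "f * f = f" using add_swap[of f "f * f" 0] by simp
  have ee: "e * e = e" and ef: "e * f = 0"
    using fe ff by (auto simp: e_def distrib_left distrib_right double_zero double_zero_left)
  have cSf: "commute S f" "commute f S"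
    unfolding f_def using S(1) by (intro commute_intros; simp add: commute_sym)+
  then have cSe: "commute S e" "commute e S"
    unfolding e_def by (intro commute_intros; simp)+
  \<comment> \<open>\<open>S\<close> on the image of \<open>f\<close>, extended by the identity on
    the image of \<open>e\<close>.\<close>
  define S1 where "S1 = S * f + e"
  have S1i: "S1 ^ i = S ^ i * f + e" for i
  proof (induction i)
    case (Suc i)
    have "S1 ^ Suc i = (S * f + e) * (S ^ i * f + e)"
      by (simp add: Suc flip: S1_def)
    also have "\<dots> = S * (f * S ^ i) * f + S * (f * e) + e * S ^ i * f + e * e"
      by (simp add: algebra_simps)
    also have "\<dots> = S ^ Suc i * f + e"
    proof -
      have "f * S ^ i = S ^ i * f" "e * S ^ i = S ^ i * e"
        using cSf cSe by (simp_all add: commute_power_right flip: commute_def)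
      then show ?thesis by (simp add: fe ee ef ff mult.assoc)
    qed
    finally show ?case .
  qed (simp add: e_def add_ac double_zero double_zero_left)
  have S1n: "S1 ^ n = 1"
    by (simp add: S1i S e_def add_ac double_zero double_zero_left)
  have star_e: "star e = e" by (simp add: e_def star_add star_f)
  have S1star: "star S1 = S1"
    using cSf by (simp add: S1_def star_add star_mult star_e star_f S commute_def)
  have cXf: "commute X f" "commute f X"
    unfolding f_def by (intro commute_intros)+
  then have cXe: "commute e X" unfolding e_def by (intro commute_intros; simp)+
  have cS1X: "commute S1 X" unfolding S1_def using cXf cXe S(1) by (intro commute_intros; simp)+
  have czX: "commute X z" "commute X (star z)"
    unfolding star_z unfolding z_def by (intro commute_intros)+
  have czz: "commute z (star z)"
    unfolding star_z unfolding z_def by (intro commute_intros)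
  have cS1z: "commute S1 z" "commute S1 (star z)"
    unfolding star_z unfolding z_def using cS1X by (intro commute_intros; simp)+
  obtain k d where kd: "n = 2 ^ k * d" "odd d"
    using S(4) nat_odd_part by blast
  \<comment> \<open>The exponent \<open>(n - 1) * d\<close> stands for \<open>- d\<close>: together
    with the two factors \<open>a\<close> of total exponent \<open>d + 1\<close> it gives
    \<open>1 + n * d\<close>, which is 1 modulo \<open>n\<close>. Multiplying it by
    \<open>2 ^ k\<close> gives a multiple of \<open>n\<close>, so \<open>S'\<close> has order a
    power of two.\<close>
  define a where "a = S1 ^ ((d + 1) div 2)"
  define S' where "S' = S1 ^ ((n - 1) * d)"
  have S1_eq: "a * S' * star a = S1"
  proof -
    have "a * S' * star a = S1 ^ ((d + 1) div 2 + (n - 1) * d + (d + 1) div 2)"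
      by (simp add: a_def S'_def star_power S1star power_add)
    also have "(d + 1) div 2 + (n - 1) * d + (d + 1) div 2 = 1 + n * d"
      using kd(2) S(4) by (cases n) (auto elim!: oddE)
    also have "S1 ^ (1 + n * d) = S1" by (simp add: power_add power_mult S1n)
    finally show ?thesis .
  qed
  have "S' ^ (2 ^ k) = S1 ^ (n * (n - 1))"
    unfolding S'_def by (simp add: kd mult_ac flip: power_mult)
  then have "S' ^ (2 ^ k) = 1" by (simp add: power_mult S1n)
  then have nil: "(S' + 1) ^ (2 ^ k) = 0"
    using one_add_power2[of S' k] by (simp only: one_plus_one add.commute)
  \<comment> \<open>\<open>S1\<close> is the identity on the image of \<open>e\<close>, hence so is
    its power \<open>S'\<close>. Thus \<open>e\<close> kills \<open>S' + 1\<close>, and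
    \<open>f = z + star z\<close> fixes it.\<close>
  have "e * S' = e"
  proof -
    have eS: "e * S ^ j = S ^ j * e" for j
      using cSe by (simp add: commute_power_right flip: commute_def)
    have "e * (S ^ j * f) = 0" for j
    proof -
      have "e * (S ^ j * f) = S ^ j * (e * f)" by (simp add: eS flip: mult.assoc)
      then show ?thesis by (simp add: ef)
    qed
    then show ?thesis
      unfolding S'_def S1i by (simp add: distrib_left ee)
  qed
  then have "S' + f * S' = 1 + f" by (simp add: e_def distrib_right)
  then have fS': "(z + star z) * (S' + 1) = S' + 1"
    unfolding zz using add_swap[of S' "f * S'" "1 + f"] by (simp add: distrib_left add_ac double_zero)
  have "\<exists>g. g * star g = S' \<and> commute g X"
    using nil fS' czz czX cS1z cS1X S1star
    by (intro norm_eq_unipotent[of S' z X k]) (simp_all add: S'_def star_power commute_power_left)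
  then obtain g where g: "g * star g = S'" "commute g X" by blast
  have "(a * g) * star (a * g) = S1"
    unfolding S1_eq[symmetric] g(1)[symmetric] by (simp add: star_mult mult.assoc)
  moreover have "commute (a * g) X"
    using g cS1X unfolding a_def by (intro commute_intros; simp)+
  moreover have "(a * g) * (star (a * g) * S1 ^ (n - 1)) = 1"
  proof -
    have "S1 * S1 ^ (n - 1) = 1" using S1n S(4) by (simp flip: power_Suc)
    then show ?thesis using calculation(1) by (simp flip: mult.assoc)
  qed
  ultimately have "(a * g) * star (a * g) = S * f + (1 + f) \<and>
      (a * g) * (star (a * g) * S1 ^ (n - 1)) = 1 \<and> commute (a * g) X"
    by (simp add: S1_def e_def)
  then show "\<exists>g y. g * star g = S * f + (1 + f) \<and> g * y = 1 \<and> commute g X"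
    by (intro exI)
qed

end

section \<open>Quadratic forms in characteristic two and their Gauss sums\<close>

text \<open>Over a finite field of characteristic two this is the additive character given by -1 to
  the power of the absolute trace: the trace vanishes exactly on the elements
  \<open>t\<^sup>2 + t\<close>. Integer values suffice for it.\<close>

definition artin_schreier_sign :: "'a::field \<Rightarrow> int" where
  "artin_schreier_sign a = (if \<exists>t. a = t\<^sup>2 + t then 1 else - 1)"

text \<open>For a nondegenerate form on a space of dimension 2r over a field of q elements this is
  q^r or -q^r; the sign carries the Arf invariant.\<close>

definition gauss_sum :: "('a::field ^ 'n \<Rightarrow> 'a) \<Rightarrow> ('a ^ 'n) set \<Rightarrow> int" where
  "gauss_sum Q U = (\<Sum>u\<in>U. artin_schreier_sign (Q u))"

definition nondegenerate_on :: "('a::field ^ 'n \<Rightarrow> 'a) \<Rightarrow> ('a ^ 'n) set \<Rightarrow> bool" where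
  "nondegenerate_on Q U \<longleftrightarrow> (\<forall>u\<in>U. (\<forall>v\<in>U. polar_form Q u v = 0) \<longrightarrow> u = 0)"

section \<open>The Artin-Schreier sign as an additive character\<close>

context
  assumes char2: "(1::'a::{field,finite}) + 1 = 0"
begin

lemma field_double: "x + x = (0::'a)"
  using distrib_left[of x 1 1] by (simp only: char2 mult_1_right mult_zero_right)

lemma field_two: "(2::'a) = 0"
  using char2 by simp

lemma field_minus: "- x = (x::'a)" "x - y = x + (y::'a)"
  using field_double[of x] field_double[of y] by (simp_all add: eq_neg_iff_add_eq_0 diff_eq_eq add.assoc)

lemma field_double_left: "x + (x + y) = (y::'a)"
  by (simp add: field_double flip: add.assoc)

lemma field_add_eq_0: "x + y = 0 \<longleftrightarrow> x = (y::'a)"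
  using field_minus(1)[of y] add_eq_0_iff2[of x y] by (simp only:)

lemma square_add: "(x + y)\<^sup>2 = x\<^sup>2 + (y::'a)\<^sup>2"
proof -
  have "(x + y)\<^sup>2 = x\<^sup>2 + y\<^sup>2 + (x * y + x * y)"
    by (simp add: power2_eq_square algebra_simps)
  then show ?thesis by (simp add: field_double)
qed

lemma square_surj: "\<exists>x. x\<^sup>2 = (a::'a)"
proof -
  have "inj (\<lambda>x::'a. x\<^sup>2)"
  proof (rule injI)
    fix x y :: 'a assume "x\<^sup>2 = y\<^sup>2"
    then have "(x + y)\<^sup>2 = 0" by (simp add: square_add field_double)
    then show "x = y" by (simp add: field_add_eq_0)
  qed
  then have "surj (\<lambda>x::'a. x\<^sup>2)" by (simp add: finite_UNIV_inj_surj)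
  then show ?thesis by (metis surjD)
qed

text \<open>The map is additive with kernel {0, 1}: the values at \<open>x\<close> and
  \<open>t\<close> differ by \<open>(x + t) * (x + t + 1)\<close>, so every fibre has two
  elements.\<close>

lemma card_artin_schreier: "2 * card (range (\<lambda>t::'a. t\<^sup>2 + t)) = CARD('a)"
proof -
  let ?p = "\<lambda>t::'a. t\<^sup>2 + t"
  have fibre: "{x \<in> UNIV. ?p x = ?p t} = {t, t + 1}" for t
  proof -
    have "?p x = ?p t \<longleftrightarrow> x = t \<or> x = t + 1" for x
    proof -
      have "?p x = ?p t \<longleftrightarrow> (x + t) * (x + t + 1) = 0"
      proof -
        have "?p x + ?p t = (x + t)\<^sup>2 + (x + t)" by (simp add: square_add add_ac)
        also have "\<dots> = (x + t) * (x + t + 1)" by (simp add: power2_eq_square distrib_left)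
        finally show ?thesis by (metis field_add_eq_0)
      qed
      also have "\<dots> \<longleftrightarrow> x = t \<or> x = t + 1" by (simp add: field_add_eq_0 add.assoc)
      finally show ?thesis .
    qed
    then show ?thesis by auto
  qed
  have "CARD('a) = (\<Sum>y\<in>range ?p. card {x \<in> UNIV. ?p x = y})"
    using sum.image_gen[of UNIV "\<lambda>_. 1::nat" ?p] by simp
  also have "\<dots> = (\<Sum>y\<in>range ?p. 2)"
  proof (rule sum.cong[OF refl])
    fix y assume "y \<in> range ?p"
    then obtain t where "y = ?p t" by blast
    then show "card {x \<in> UNIV. ?p x = y} = 2" using fibre[of t] by simp
  qed
  finally show ?thesis by simp
qed

text \<open>The elements of sign 1 form an additive subgroup \<open>P\<close> of index two. For two
  elements outside \<open>P\<close>, the coset of the first is disjoint from \<open>P\<close> and by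
  cardinality fills the complement, so it contains the second.\<close>

lemma artin_schreier_sign_add:
  "artin_schreier_sign (a + b) = artin_schreier_sign a * artin_schreier_sign (b::'a)"
proof -
  define P where "P = range (\<lambda>t::'a. t\<^sup>2 + t)"
  have sgn: "artin_schreier_sign c = (if c \<in> P then 1 else - 1)" for c
    by (auto simp: artin_schreier_sign_def P_def)
  have add: "c + d \<in> P" if cd: "c \<in> P" "d \<in> P" for c d
  proof -
    obtain s t where "c = s\<^sup>2 + s" "d = t\<^sup>2 + t" using cd by (auto simp: P_def)
    then have "c + d = (s + t)\<^sup>2 + (s + t)" by (simp add: square_add add_ac)
    then show ?thesis by (auto simp: P_def)
  qed
  have notin: "c + d \<notin> P" if "c \<in> P" "d \<notin> P" for c d
    using add[of c "c + d"] that by (auto simp: field_double_left)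
  have add': "c + d \<in> P" if cd: "c \<notin> P" "d \<notin> P" for c d
  proof -
    have "inj_on ((+) c) P" by simp
    then have "card ((+) c ` P) = card P" by (rule card_image)
    moreover have "P \<inter> (+) c ` P = {}" using notin cd(1) by (auto simp: add.commute)
    ultimately have "card (P \<union> (+) c ` P) = CARD('a)"
      using card_artin_schreier by (simp add: card_Un_disjoint P_def[symmetric])
    then have "P \<union> (+) c ` P = UNIV" by (simp add: card_eq_UNIV_imp_eq_UNIV)
    then obtain p where "p \<in> P" "d = c + p" using cd(2) by blast
    then show ?thesis by (simp add: field_double_left)
  qed
  show ?thesis
    using add[of a b] add'[of a b] notin[of a b] notin[of b a] by (auto simp: sgn add.commute)
qed

lemma artin_schreier_sign_cases: "artin_schreier_sign (a::'a) = 1 \<or> artin_schreier_sign (a::'a) = - 1"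
  by (simp add: artin_schreier_sign_def)

lemma artin_schreier_sign_0 [simp]: "artin_schreier_sign (0::'a) = 1"
  by (auto simp: artin_schreier_sign_def intro: exI[of _ 0])

lemma artin_schreier_sign_square: "artin_schreier_sign ((x::'a)\<^sup>2) = artin_schreier_sign x"
proof -
  have "artin_schreier_sign (x\<^sup>2 + x) = 1" by (auto simp: artin_schreier_sign_def)
  then show ?thesis
    using artin_schreier_sign_cases[of x] by (auto simp: artin_schreier_sign_add)
qed

lemma artin_schreier_sign_nontrivial: "\<exists>a::'a. artin_schreier_sign a = - 1"
proof (rule ccontr)
  assume "\<not> ?thesis"
  then have "range (\<lambda>t::'a. t\<^sup>2 + t) = UNIV"
    unfolding artin_schreier_sign_def by (auto split: if_splits)
  then have "CARD('a) = 0" using card_artin_schreier by simp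
  then show False by simp
qed

text \<open>Orthogonality of characters: for nonzero \<open>a\<close>, translating \<open>x\<close>
  by \<open>b / a\<close> with \<open>b\<close> of sign -1 negates the sum.\<close>

lemma sum_artin_schreier_sign:
  "(\<Sum>x\<in>UNIV. artin_schreier_sign (x * a)) = (if a = (0::'a) then int CARD('a) else 0)"
proof (cases "a = 0")
  case False
  obtain b :: 'a where b: "artin_schreier_sign b = - 1"
    using artin_schreier_sign_nontrivial by blast
  let ?S = "\<Sum>x\<in>UNIV. artin_schreier_sign (x * a)"
  have "?S = (\<Sum>x\<in>UNIV. artin_schreier_sign ((x + b / a) * a))"
    by (rule sum.reindex_bij_witness[of _ "\<lambda>x. x + b / a" "\<lambda>x. x - b / a"]) auto
  also have "\<dots> = (\<Sum>x\<in>UNIV. - artin_schreier_sign (x * a))"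
    using False b by (simp add: distrib_right artin_schreier_sign_add)
  also have "\<dots> = - ?S" by (rule sum_negf)
  finally show ?thesis using False by simp
qed simp

end

section \<open>Splitting off planes from a quadratic space\<close>

locale quadratic_space =
  fixes Q :: "'a::{field,finite} ^ 'n \<Rightarrow> 'a"
  assumes quadratic: "quadratic_form Q" and char2: "(1::'a) + 1 = 0"
begin

abbreviation \<beta> where "\<beta> \<equiv> polar_form Q"

lemmas field_double = field_double[OF char2]
  and field_double_left = field_double_left[OF char2]
  and field_two = field_two[OF char2]
  and field_minus = field_minus[OF char2]

lemma Q_scale: "Q (a *s v) = a\<^sup>2 * Q v"
  using quadratic by (simp add: quadratic_form_def)

lemma Q_0 [simp]: "Q 0 = 0"
  using Q_scale[of 0 0] by simp

lemma Q_add: "Q (u + v) = Q u + Q v + \<beta> u v"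
  by (simp add: polar_form_def)

lemma beta_linear:
  "\<beta> (u + v) w = \<beta> u w + \<beta> v w" "\<beta> w (u + v) = \<beta> w u + \<beta> w v"
  "\<beta> (a *s u) v = a * \<beta> u v" "\<beta> u (a *s v) = a * \<beta> u v"
  using quadratic unfolding quadratic_form_def bilinear_form_def Vector_Spaces.linear_iff by blast+

lemma vec_double: "v + v = (0 :: 'a ^ 'n)"
  by (simp add: vec_eq_iff field_two)

lemma vec_double_left: "v + (v + w) = (w :: 'a ^ 'n)"
  by (simp add: vec_double flip: add.assoc)

lemma beta_zero [simp]: "\<beta> 0 v = 0" "\<beta> v 0 = 0"
  using beta_linear(3)[of 0 0 v] beta_linear(4)[of v 0 0] by simp_all

lemma beta_commute: "\<beta> u v = \<beta> v u"
  by (simp add: polar_form_def add.commute)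

lemma beta_self [simp]: "\<beta> v v = 0"
  by (simp add: polar_form_def vec_double field_minus field_double)

text \<open>If \<open>Q\<close> vanished on \<open>U\<close>, so would its polar form; a vector with
  nonzero value is rescaled to value 1, as every scalar is a square. The normalization
  \<open>Q e = 1\<close> is available in anisotropic planes too; the plane contains a nonzero
  singular vector exactly if \<open>Q f\<close> has the form \<open>t\<^sup>2 + t\<close>.\<close>

lemma hyperbolic_pair:
  assumes U: "vec.subspace U" "nondegenerate_on Q U" "U \<noteq> {0}"
  shows "\<exists>e\<in>U. \<exists>f\<in>U. Q e = 1 \<and> \<beta> e f = 1"
proof -
  obtain u where u: "u \<in> U" "u \<noteq> 0" using U(1,3) vec.subspace_0 by blast
  then obtain v where v: "v \<in> U" "\<beta> u v \<noteq> 0" using U(2) by (auto simp: nondegenerate_on_def)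
  have "\<exists>w\<in>U. Q w \<noteq> 0"
  proof (rule ccontr)
    assume "\<not> ?thesis"
    then have "Q u = 0" "Q v = 0" "Q (u + v) = 0"
      using u v vec.subspace_add[OF U(1)] by simp_all
    then show False using v(2) Q_add[of u v] by simp
  qed
  then obtain w where w: "w \<in> U" "Q w \<noteq> 0" by blast
  obtain a where a: "a\<^sup>2 = 1 / Q w" using square_surj[OF char2] by blast
  define e where "e = a *s w"
  have e: "e \<in> U" "Q e = 1" using w a U(1) by (auto simp: e_def Q_scale vec.subspace_scale)
  then have "e \<noteq> 0" by auto
  then obtain g where g: "g \<in> U" "\<beta> e g \<noteq> 0" using e U(2) by (auto simp: nondegenerate_on_def)
  then have "\<beta> e ((1 / \<beta> e g) *s g) = 1" by (simp add: beta_linear)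
  then show ?thesis using e g U(1) vec.subspace_scale by blast
qed

definition pair_complement where
  "pair_complement U e f = {u \<in> U. \<beta> u e = 0 \<and> \<beta> u f = 0}"

lemma Q_pair_expansion:
  assumes "Q e = 1" "\<beta> e f = 1" "\<beta> w e = 0" "\<beta> w f = 0"
  shows "Q (x *s e + y *s f + w) = x\<^sup>2 + x * y + y\<^sup>2 * Q f + Q w"
  using assms beta_commute[of e w] beta_commute[of f w]
  by (simp add: Q_add Q_scale beta_linear)

context
  fixes U e f
  assumes U: "vec.subspace U" and ef: "e \<in> U" "f \<in> U" "Q e = 1" "\<beta> e f = 1"
begin

lemma subspace_pair_complement: "vec.subspace (pair_complement U e f)"
  using U unfolding vec.subspace_def pair_complement_def by (auto simp: beta_linear)

text \<open>Orthogonal projection away from the plane: the coordinate at \<open>e\<close> is read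
  off by pairing with \<open>f\<close> and conversely, and signs disappear in characteristic
  two.\<close>

lemma pair_projection_mem:
  assumes "u \<in> U"
  shows "u + (\<beta> u f *s e + \<beta> u e *s f) \<in> pair_complement U e f"
  using assms ef U beta_commute[of f e]
  by (auto simp: pair_complement_def beta_linear field_double vec.subspace_add vec.subspace_scale)

lemma nondegenerate_on_pair_complement:
  assumes "nondegenerate_on Q U"
  shows "nondegenerate_on Q (pair_complement U e f)"
  unfolding nondegenerate_on_def
proof (intro ballI impI)
  fix w assume w: "w \<in> pair_complement U e f" "\<forall>v\<in>pair_complement U e f. \<beta> w v = 0"
  have "\<beta> w u = 0" if "u \<in> U" for u
    using w(2)[rule_format, OF pair_projection_mem[OF that]] w(1)
    by (simp add: beta_linear pair_complement_def)
  then show "w = 0" using assms w(1) by (auto simp: nondegenerate_on_def pair_complement_def)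
qed

text \<open>Every vector of \<open>U\<close> is uniquely a vector of the plane plus one of its
  complement. With \<open>F\<close> arbitrary this yields both the cardinality and the Gauss
  sum.\<close>

lemma sum_over_pair_decomposition:
  "(\<Sum>u\<in>U. F u) =
    (\<Sum>x\<in>UNIV. \<Sum>y\<in>UNIV. \<Sum>w\<in>pair_complement U e f. F (x *s e + y *s f + w))"
  for F :: "'a ^ 'n \<Rightarrow> 'b::comm_monoid_add"
proof -
  have "(\<Sum>(x, y, w)\<in>UNIV \<times> UNIV \<times> pair_complement U e f. F (x *s e + y *s f + w)) = (\<Sum>u\<in>U. F u)"
  proof (rule sum.reindex_bij_witness[of _
        "\<lambda>u. (\<beta> u f, \<beta> u e, u + (\<beta> u f *s e + \<beta> u e *s f))" "\<lambda>(x, y, w). x *s e + y *s f + w"])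
    fix t :: "'a \<times> 'a \<times> ('a ^ 'n)"
    assume t: "t \<in> UNIV \<times> UNIV \<times> pair_complement U e f"
    obtain x y w where t_eq: "t = (x, y, w)" by (cases t) auto
    have w: "w \<in> U" "\<beta> w e = 0" "\<beta> w f = 0" using t by (auto simp: t_eq pair_complement_def)
    define u where "u = x *s e + y *s f + w"
    have "\<beta> u f = x" "\<beta> u e = y"
      using ef w beta_commute[of f e] by (simp_all add: u_def beta_linear)
    moreover have "u + (x *s e + y *s f) = w"
      by (simp add: u_def add_ac vec_double vec_double_left)
    ultimately have "(\<beta> u f, \<beta> u e, u + (\<beta> u f *s e + \<beta> u e *s f)) = t"
      by (simp add: t_eq)
    moreover have "u = (case t of (x, y, w) \<Rightarrow> x *s e + y *s f + w)"
      by (simp add: t_eq u_def)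
    ultimately show "(\<beta> (case t of (x, y, w) \<Rightarrow> x *s e + y *s f + w) f,
        \<beta> (case t of (x, y, w) \<Rightarrow> x *s e + y *s f + w) e,
        (case t of (x, y, w) \<Rightarrow> x *s e + y *s f + w) +
          (\<beta> (case t of (x, y, w) \<Rightarrow> x *s e + y *s f + w) f *s e +
           \<beta> (case t of (x, y, w) \<Rightarrow> x *s e + y *s f + w) e *s f)) = t"
      by simp
    show "(case t of (x, y, w) \<Rightarrow> x *s e + y *s f + w) \<in> U"
      using w ef U by (simp add: t_eq vec.subspace_add vec.subspace_scale)
  qed (use pair_projection_mem in \<open>auto simp: add_ac vec_double vec_double_left\<close>)
  then show ?thesis by (simp add: sum.cartesian_product)
qed

lemma card_pair_decomposition: "card U = CARD('a) * CARD('a) * card (pair_complement U e f)"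
  using sum_over_pair_decomposition[of "\<lambda>_. 1::nat"] by simp

text \<open>The sign does not distinguish \<open>x\<^sup>2\<close> from \<open>x\<close>, so the
  terms involving \<open>x\<close> combine to the character at \<open>x * (1 + y)\<close>. Summing
  over \<open>x\<close> leaves only \<open>y = 1\<close>.\<close>

lemma gauss_sum_pair_decomposition:
  "gauss_sum Q U =
    int CARD('a) * artin_schreier_sign (Q f) * gauss_sum Q (pair_complement U e f)"
proof -
  note sgn = artin_schreier_sign_add[OF char2] artin_schreier_sign_square[OF char2]
  let ?s = artin_schreier_sign and ?W = "pair_complement U e f"
  have "gauss_sum Q U = (\<Sum>x\<in>UNIV. \<Sum>y\<in>UNIV. \<Sum>w\<in>?W. ?s (x * (1 + y)) * ?s (y\<^sup>2 * Q f) * ?s (Q w))"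
    unfolding gauss_sum_def sum_over_pair_decomposition
    by (intro sum.cong refl)
      (use ef in \<open>simp add: Q_pair_expansion pair_complement_def sgn distrib_left mult_ac\<close>)
  also have "\<dots> = (\<Sum>x\<in>UNIV. \<Sum>y\<in>UNIV. ?s (x * (1 + y)) * (?s (y\<^sup>2 * Q f) * gauss_sum Q ?W))"
    by (simp add: gauss_sum_def sum_distrib_left mult.assoc)
  also have "\<dots> = (\<Sum>y\<in>UNIV. (\<Sum>x\<in>UNIV. ?s (x * (1 + y))) * (?s (y\<^sup>2 * Q f) * gauss_sum Q ?W))"
    by (subst sum.swap) (simp add: sum_distrib_right)
  also have "\<dots> = (\<Sum>y\<in>(UNIV :: 'a set). if y = 1 then int CARD('a) * (?s (Q f) * gauss_sum Q ?W) else 0)"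
    by (rule sum.cong[OF refl])
      (auto simp: sum_artin_schreier_sign[OF char2] field_add_eq_0[OF char2])
  finally show ?thesis by simp
qed

text \<open>Adding to \<open>f\<close> a multiple of a complement vector of value 1 leaves the
  pairing with \<open>e\<close> alone and can shift \<open>Q f\<close> by any square, that is, by
  any scalar.\<close>

lemma isotropic_partner:
  assumes "nondegenerate_on Q U" "pair_complement U e f \<noteq> {0}"
  shows "\<exists>g\<in>U. \<beta> e g = 1 \<and> Q g = 0"
proof -
  obtain w where w: "w \<in> pair_complement U e f" "Q w = 1"
    using hyperbolic_pair[OF subspace_pair_complement nondegenerate_on_pair_complement] assms
    by blast
  obtain a where a: "a\<^sup>2 = Q f" using square_surj[OF char2] by blast
  have "f + a *s w \<in> U" "\<beta> e (f + a *s w) = 1" "Q (f + a *s w) = 0"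
    using w ef a U beta_commute[of e w] beta_commute[of f w]
    by (auto simp: pair_complement_def Q_add Q_scale beta_linear field_double
        vec.subspace_add vec.subspace_scale)
  then show ?thesis by blast
qed

end

text \<open>Each plane split off contributes the field size up to sign. This later permits
  cancelling a common factor of two Gauss sums.\<close>

lemma gauss_sum_nonzero:
  assumes "vec.subspace U" "nondegenerate_on Q U"
  shows "gauss_sum Q U \<noteq> 0"
  using assms
proof (induction "card U" arbitrary: U rule: less_induct)
  case less
  show ?case
  proof (cases "U = {0}")
    case True
    then show ?thesis by (simp add: gauss_sum_def artin_schreier_sign_0[OF char2])
  next
    case False
    then obtain e f where ef: "e \<in> U" "f \<in> U" "Q e = 1" "\<beta> e f = 1"
      using hyperbolic_pair less.prems by blast
    note pair = less.prems(1) ef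
    have "f \<notin> pair_complement U e f"
      using ef beta_commute[of e f] by (auto simp: pair_complement_def)
    then have "pair_complement U e f \<subset> U" using ef by (auto simp: pair_complement_def)
    then have "card (pair_complement U e f) < card U" by (simp add: psubset_card_mono)
    then have "gauss_sum Q (pair_complement U e f) \<noteq> 0"
      using less.hyps subspace_pair_complement[OF pair]
        nondegenerate_on_pair_complement[OF pair less.prems(2)] by blast
    then show ?thesis
      using artin_schreier_sign_cases[OF char2, of "Q f"]
      by (auto simp: gauss_sum_pair_decomposition[OF pair])
  qed
qed

end

text \<open>A nondegenerate space of dimension at least four contains a hyperbolic plane; in dimension
  two, the Gauss sum determines the class of \<open>Q f\<close> modulo \<open>{t\<^sup>2 + t | t}\<close>.\<close>

lemma matching_pairs:
  assumes Q: "quadratic_space Q" and Q': "quadratic_space Q'"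
    and U: "vec.subspace U" "nondegenerate_on Q U" "U \<noteq> {0}"
    and U': "vec.subspace U'" "nondegenerate_on Q' U'" 
    and eq: "card U = card U'" "gauss_sum Q U = gauss_sum Q' U'"
  shows "\<exists>e\<in>U. \<exists>f\<in>U. \<exists>e'\<in>U'. \<exists>f'\<in>U'. Q e = 1 \<and> polar_form Q e f = 1 \<and> Q' e' = 1 \<and>
    polar_form Q' e' f' = 1 \<and> Q' f' = Q f"
proof -
  interpret Q: quadratic_space Q by (rule Q)
  interpret Q': quadratic_space Q' by (rule Q')
  have "U' \<noteq> {0}"
  proof
    assume "U' = {0}"
    then have "card U = 1" using eq by simp
    then show False using U vec.subspace_0[OF U(1)] by (auto simp: card_1_singleton_iff)
  qed
  then obtain e' f' where ef': "e' \<in> U'" "f' \<in> U'" "Q' e' = 1" "polar_form Q' e' f' = 1"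
    using Q'.hyperbolic_pair U' by blast
  obtain e f where ef: "e \<in> U" "f \<in> U" "Q e = 1" "polar_form Q e f = 1"
    using Q.hyperbolic_pair U by blast
  note pair = U(1) ef and pair' = U'(1) ef'
  let ?W = "Q.pair_complement U e f" and ?W' = "Q'.pair_complement U' e' f'"
  have cards: "card ?W = card ?W'"
    using eq(1) Q.card_pair_decomposition[OF pair] Q'.card_pair_decomposition[OF pair'] by simp
  show ?thesis
  proof (cases "?W = {0}")
    case False
    have "?W' \<noteq> {0}"
    proof
      assume "?W' = {0}"
      then have "card ?W = 1" using cards by simp
      then show False
        using False vec.subspace_0[OF Q.subspace_pair_complement[OF pair]]
        by (auto simp: card_1_singleton_iff)
    qed
    then show ?thesis
      using Q.isotropic_partner[OF pair U(2) False] Q'.isotropic_partner[OF pair' U'(2)] ef ef'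
      by metis
  next
    case True
    then have "card ?W' = 1" using cards by simp
    then have W': "?W' = {0}"
      using vec.subspace_0[OF Q'.subspace_pair_complement[OF pair']]
      by (auto simp: card_1_singleton_iff)
    have "int CARD('a) * artin_schreier_sign (Q f) = int CARD('a) * artin_schreier_sign (Q' f')"
      using eq(2) Q.gauss_sum_pair_decomposition[OF pair] Q'.gauss_sum_pair_decomposition[OF pair']
      by (simp add: True W' gauss_sum_def artin_schreier_sign_0[OF Q.char2])
    then have "artin_schreier_sign (Q f + Q' f') = 1"
      using artin_schreier_sign_cases[OF Q.char2, of "Q f"]
      by (auto simp: artin_schreier_sign_add[OF Q.char2])
    then obtain t where t: "Q f + Q' f' = t\<^sup>2 + t"
      by (auto simp: artin_schreier_sign_def split: if_splits)
    \<comment> \<open>Adding \<open>t *s e'\<close> to \<open>f'\<close> changes its value by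
      exactly \<open>t\<^sup>2 + t\<close>.\<close>
    define g where "g = f' + t *s e'"
    have "g \<in> U'" using ef' U' by (simp add: g_def vec.subspace_add vec.subspace_scale)
    moreover have "polar_form Q' e' g = 1" using ef' by (simp add: g_def Q'.beta_linear)
    moreover have "Q' g = Q f"
    proof -
      have "Q' g = Q' f' + (t\<^sup>2 + t)"
        using ef' Q'.beta_commute[of f' e']
        by (simp add: g_def Q'.Q_add Q'.Q_scale Q'.beta_linear add.assoc)
      then show ?thesis
        unfolding t[symmetric] by (simp add: add_ac Q.field_double_left Q.field_two)
    qed
    ultimately show ?thesis using ef ef' by blast
  qed
qed

text \<open>Matching planes are split off on both sides; they contribute the same nonzero factor, so
  the complements again have equal cardinalities and Gauss sums. The map is linear on the whole
  space but controlled only on \<open>U\<close>, which avoids a separate notion of linearity on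
  subspaces.\<close>

theorem isometry_if_gauss_sum_eq:
  fixes Q Q' :: "'a::{field,finite} ^ 'n \<Rightarrow> 'a"
  assumes Q: "quadratic_space Q" and Q': "quadratic_space Q'"
    and "vec.subspace U" "nondegenerate_on Q U" "vec.subspace U'" "nondegenerate_on Q' U'"
    and "card U = card U'" "gauss_sum Q U = gauss_sum Q' U'"
  shows "\<exists>h. Vector_Spaces.linear (*s) (*s) h \<and> (\<forall>u\<in>U. h u \<in> U' \<and> Q' (h u) = Q u)"
  using assms(3-)
proof (induction "card U" arbitrary: U U' rule: less_induct)
  case less
  interpret Q: quadratic_space Q by (rule Q)
  interpret Q': quadratic_space Q' by (rule Q')
  show ?case
  proof (cases "U = {0}")
    case True
    have "Vector_Spaces.linear (*s) (*s) (\<lambda>v::'a ^ 'n. 0 :: 'a ^ 'n)"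
      by (simp add: Vector_Spaces.linear_iff vec.vector_space_axioms)
    then show ?thesis
      using True vec.subspace_0[OF less.prems(3)] by (intro exI[of _ "\<lambda>v. 0"]) simp
  next
    case False
    obtain e f e' f' where ef: "e \<in> U" "f \<in> U" "Q e = 1" "polar_form Q e f = 1"
      and ef': "e' \<in> U'" "f' \<in> U'" "Q' e' = 1" "polar_form Q' e' f' = 1" and Qf: "Q' f' = Q f"
      using matching_pairs[OF Q Q' less.prems(1,2) False less.prems(3-)] by metis
    note pair = less.prems(1) ef and pair' = less.prems(3) ef'
    let ?W = "Q.pair_complement U e f" and ?W' = "Q'.pair_complement U' e' f'"
    have "f \<notin> ?W"
      using ef Q.beta_commute[of e f] by (auto simp: Q.pair_complement_def)
    then have "?W \<subset> U" using ef by (auto simp: Q.pair_complement_def)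
    then have lt: "card ?W < card U" by (simp add: psubset_card_mono)
    have "card ?W = card ?W'"
      using less.prems(5) Q.card_pair_decomposition[OF pair] Q'.card_pair_decomposition[OF pair']
      by simp
    moreover have "gauss_sum Q ?W = gauss_sum Q' ?W'"
      using less.prems(6) Q.gauss_sum_pair_decomposition[OF pair]
        Q'.gauss_sum_pair_decomposition[OF pair'] artin_schreier_sign_cases[OF Q.char2, of "Q f"]
      by (auto simp: Qf)
    ultimately obtain h where h: "Vector_Spaces.linear (*s) (*s) h"
      and hW: "\<And>w. w \<in> ?W \<Longrightarrow> h w \<in> ?W' \<and> Q' (h w) = Q w"
      using less.hyps[OF lt Q.subspace_pair_complement[OF pair]
          Q.nondegenerate_on_pair_complement[OF pair less.prems(2)]
          Q'.subspace_pair_complement[OF pair']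
          Q'.nondegenerate_on_pair_complement[OF pair' less.prems(4)]] by metis
    let ?\<beta> = "polar_form Q"
    \<comment> \<open>Sends \<open>e\<close> to \<open>e'\<close> and \<open>f\<close> to
      \<open>f'\<close>, and applies \<open>h\<close> to the component in the complement.\<close>
    define H where "H u = ?\<beta> u f *s e' + ?\<beta> u e *s f' + h (u + (?\<beta> u f *s e + ?\<beta> u e *s f))" for u
    have hl: "h (u + v) = h u + h v" "h (a *s u) = a *s h u" for u v a
      using h by (simp_all add: Vector_Spaces.linear_iff)
    have "Vector_Spaces.linear (*s) (*s) H"
      unfolding Vector_Spaces.linear_iff
      by (auto simp: H_def hl Q.beta_linear vector_space_over_itself.scale_scale algebra_simps
          vec.scale_left_distrib vec.scale_right_distrib vec.vector_space_axioms)
    moreover have "H u \<in> U' \<and> Q' (H u) = Q u" if u: "u \<in> U" for u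
    proof -
      define w where "w = u + (?\<beta> u f *s e + ?\<beta> u e *s f)"
      have w: "w \<in> ?W" unfolding w_def by (rule Q.pair_projection_mem[OF pair u])
      then have hw: "h w \<in> ?W'" "Q' (h w) = Q w" using hW by auto
      have H: "H u = ?\<beta> u f *s e' + ?\<beta> u e *s f' + h w" by (simp add: H_def w_def)
      have u_eq: "u = ?\<beta> u f *s e + ?\<beta> u e *s f + w"
        by (simp add: w_def add_ac Q.vec_double Q.vec_double_left)
      have "Q' (H u) = Q (?\<beta> u f *s e + ?\<beta> u e *s f + w)"
        using hw w ef ef' by (simp add: H Q'.Q_pair_expansion Q.Q_pair_expansion Qf
            Q.pair_complement_def Q'.pair_complement_def)
      moreover have "H u \<in> U'"
        using hw(1) ef' less.prems(3)
        by (simp add: H Q'.pair_complement_def vec.subspace_add vec.subspace_scale)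
      ultimately show ?thesis by (simp flip: u_eq)
    qed
    ultimately show ?thesis by blast
  qed
qed

section \<open>The ring of square matrices and adjoints\<close>

text \<open>A copy of the matrix type whose multiplication is \<open>**\<close>, so that the ring
  lemmas and powers apply.\<close>

typedef ('a, 'n) square_matrix = "UNIV :: ('a ^ 'n ^ 'n) set"
  morphisms matrix_of Square_Matrix ..

setup_lifting type_definition_square_matrix

lemma vector_matrix_mult_ext:
  fixes A B :: "'a::field ^ 'n ^ 'n"
  assumes "\<And>v. v v* A = v v* B"
  shows "A = B"
proof -
  have "transpose A = transpose B"
    using assms by (simp add: matrix_eq transpose_matrix_vector)
  then show ?thesis by (metis transpose_transpose)
qed

instantiation square_matrix :: (field, finite) ring_1
begin

lift_definition zero_square_matrix :: "('a, 'b) square_matrix" is 0 .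
lift_definition one_square_matrix :: "('a, 'b) square_matrix" is "mat 1" .
lift_definition plus_square_matrix ::
  "('a, 'b) square_matrix \<Rightarrow> ('a, 'b) square_matrix \<Rightarrow> ('a, 'b) square_matrix" is "(+)" .
lift_definition minus_square_matrix ::
  "('a, 'b) square_matrix \<Rightarrow> ('a, 'b) square_matrix \<Rightarrow> ('a, 'b) square_matrix" is "(-)" .
lift_definition uminus_square_matrix ::
  "('a, 'b) square_matrix \<Rightarrow> ('a, 'b) square_matrix" is "uminus" .
lift_definition times_square_matrix ::
  "('a, 'b) square_matrix \<Rightarrow> ('a, 'b) square_matrix \<Rightarrow> ('a, 'b) square_matrix" is "(**)" .

instance
proof
  fix A B C :: "('a, 'b) square_matrix"
  show "A * B * C = A * (B * C)" by transfer (simp add: matrix_mul_assoc)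
  show "(A + B) * C = A * C + B * C"
    by transfer (rule vector_matrix_mult_ext,
        simp add: vector_matrix_left_distrib vector_matrix_mult_add_rdistrib
          flip: vector_matrix_mul_assoc)
  show "A * (B + C) = A * B + A * C"
    by transfer (rule vector_matrix_mult_ext,
        simp add: vector_matrix_left_distrib vector_matrix_mult_add_rdistrib
          flip: vector_matrix_mul_assoc)
  show "(0 :: ('a, 'b) square_matrix) \<noteq> 1"
    by transfer (metis vector_matrix_mul_rid vector_matrix_mult_0_right zero_neq_one
        vec_eq_iff one_index zero_index)
qed (transfer; simp add: algebra_simps)+

end

instance square_matrix :: (finite, finite) finite
proof
  have "range (Square_Matrix :: 'a ^ 'b ^ 'b \<Rightarrow> _) = UNIV"
    by (metis matrix_of_inverse surjI)
  then show "finite (UNIV :: ('a, 'b) square_matrix set)"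
    by (metis finite finite_imageI)
qed

text \<open>Row vectors are acted on from the right, so in a product the left factor acts
  first.\<close>

definition act :: "('a::field, 'n::finite) square_matrix \<Rightarrow> 'a ^ 'n \<Rightarrow> 'a ^ 'n" where
  "act A v = v v* matrix_of A"

lemma act_simps [simp]:
  "act (A + B) v = act A v + act B v" "act (A * B) v = act B (act A v)"
  "act 0 v = 0" "act 1 v = v" "act A (u + v) = act A u + act A v" "act A (a *s v) = a *s act A v"
  "act A 0 = 0"
  by (simp_all add: act_def plus_square_matrix.rep_eq times_square_matrix.rep_eq
      zero_square_matrix.rep_eq one_square_matrix.rep_eq vector_matrix_mult_add_rdistrib
      vector_matrix_mul_assoc vector_matrix_left_distrib scalar_vector_matrix_assoc)

lemma act_sum: "act (sum A I) v = (\<Sum>i\<in>I. act (A i) v)"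
  by (induction I rule: infinite_finite_induct) auto

lemma act_eqI: "(\<And>v. act A v = act B v) \<Longrightarrow> A = B"
  unfolding act_def using vector_matrix_mult_ext matrix_of_inject by blast

lemma ex_act_eq_linear:
  assumes "Vector_Spaces.linear (*s) (*s) (h :: 'a::field ^ 'n \<Rightarrow> 'a ^ 'n)"
  shows "\<exists>A. \<forall>v. act A v = h v"
  by (rule exI[of _ "Square_Matrix (transpose (matrix h))"])
    (simp add: act_def Square_Matrix_inverse matrix_works[OF assms])

lemma quadratic_space_act:
  fixes A :: "('a::{field,finite}, 'n::finite) square_matrix"
  assumes "quadratic_space Q"
  shows "quadratic_space (\<lambda>v. Q (act A v))"
proof -
  interpret quadratic_space Q by (rule assms)
  have "polar_form (\<lambda>v. Q (act A v)) u v = \<beta> (act A u) (act A v)" for u v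
    by (simp add: polar_form_def)
  then show ?thesis
    by unfold_locales
      (simp_all add: quadratic_form_def bilinear_form_def Vector_Spaces.linear_iff Q_scale
        beta_linear vec.vector_space_axioms vector_space_over_itself.vector_space_axioms field_two)
qed

section \<open>Adjoints with respect to the polar form\<close>

locale nonsingular_quadratic_space = quadratic_space +
  assumes nonsingular: "nonsingular_form Q"
begin

lemma nondegenerate_left: "(\<And>v. \<beta> u v = 0) \<Longrightarrow> u = 0"
  using nonsingular by (simp add: nonsingular_form_def nondegenerate_def)

lemma beta_eqI: "(\<And>u. \<beta> u v = \<beta> u w) \<Longrightarrow> v = w"
proof -
  assume "\<And>u. \<beta> u v = \<beta> u w"
  then have "\<beta> (v + w) u = 0" for u
    by (simp add: beta_linear beta_commute[of _ u] field_double)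
  then have "v + w = 0" by (rule nondegenerate_left)
  then show "v = w" by (metis vec_double_left add.right_neutral)
qed

text \<open>Sending \<open>w\<close> to the values of \<beta> at the basis vectors and
  \<open>w\<close> is injective by nondegeneracy, hence surjective on the finite space.\<close>

lemma functional_representation:
  assumes "\<And>u v. \<phi> (u + v) = \<phi> u + \<phi> v" "\<And>a v. \<phi> (a *s v) = a * \<phi> v"
  shows "\<exists>w. \<forall>u. \<phi> u = \<beta> u w"
proof -
  have expand: "\<psi> u = (\<Sum>i\<in>UNIV. u $ i * \<psi> (axis i 1))"
    if "\<And>u v. \<psi> (u + v) = \<psi> u + \<psi> v" "\<And>a v. \<psi> (a *s v) = a * \<psi> v"
    for \<psi> :: "'a ^ 'b \<Rightarrow> 'a" and u
  proof -
    have "\<psi> 0 = 0" using that(2)[of 0 0] by simp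
    then have "\<psi> (sum x I) = (\<Sum>i\<in>I. \<psi> (x i))" for x and I :: "'b set"
      by (induction I rule: infinite_finite_induct) (auto simp: that(1))
    from this[of "\<lambda>i. u $ i *s axis i 1" UNIV] show ?thesis
      by (simp only: basis_expansion that(2))
  qed
  let ?F = "\<lambda>w. \<chi> i. \<beta> (axis i 1) w"
  have "inj ?F"
  proof (rule injI)
    fix v w assume "?F v = ?F w"
    then have "\<beta> (axis i 1) v = \<beta> (axis i 1) w" for i by (simp add: vec_eq_iff)
    then have "\<beta> u v = \<beta> u w" for u
      using expand[of "\<lambda>u. \<beta> u v" u] expand[of "\<lambda>u. \<beta> u w" u] by (simp add: beta_linear)
    then show "v = w" by (rule beta_eqI)
  qed
  then have "surj ?F" by (simp add: finite_UNIV_inj_surj)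
  then obtain w where "(\<chi> i. \<phi> (axis i 1)) = ?F w" by (rule surjE)
  then have "\<phi> (axis i 1) = \<beta> (axis i 1) w" for i by (simp add: vec_eq_iff)
  then have "\<phi> u = \<beta> u w" for u
    using expand[of \<phi> u] assms expand[of "\<lambda>u. \<beta> u w" u] by (simp add: beta_linear)
  then show ?thesis by blast
qed

text \<open>For each \<open>v\<close> the functional sending \<open>u\<close> to
  \<open>\<beta> (act A u) v\<close> is represented by some vector; uniqueness of that vector makes
  its dependence on \<open>v\<close> linear.\<close>

lemma ex_adjoint: "\<exists>A'. \<forall>u v. \<beta> (act A u) v = \<beta> u (act A' v)"
proof -
  have "\<exists>w. \<forall>u. \<beta> (act A u) v = \<beta> u w" for v
    by (rule functional_representation) (simp_all add: beta_linear)
  then obtain h where h: "\<And>u v. \<beta> (act A u) v = \<beta> u (h v)" by metis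
  have "h (v + w) = h v + h w" "h (a *s v) = a *s h v" for v w a
    by (rule beta_eqI, simp add: beta_linear flip: h)+
  then have "Vector_Spaces.linear (*s) (*s) h"
    by (simp add: Vector_Spaces.linear_iff vec.vector_space_axioms)
  then obtain A' where "\<forall>v. act A' v = h v" using ex_act_eq_linear by blast
  then show ?thesis by (intro exI[of _ A']) (simp add: h)
qed

definition adjoint where
  "adjoint A = (SOME A'. \<forall>u v. \<beta> (act A u) v = \<beta> u (act A' v))"

lemma adjoint: "\<beta> (act A u) v = \<beta> u (act (adjoint A) v)"
proof -
  have "\<forall>u v. \<beta> (act A u) v = \<beta> u (act (adjoint A) v)"
    unfolding adjoint_def by (rule someI_ex[OF ex_adjoint])
  then show ?thesis by blast
qed

lemma adjointI:
  assumes "\<And>u v. \<beta> (act A u) v = \<beta> u (act A' v)"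
  shows "adjoint A = A'"
proof (rule act_eqI)
  show "act (adjoint A) v = act A' v" for v
    by (rule beta_eqI) (simp add: assms flip: adjoint)
qed

sublocale adj: char2_star_ring adjoint
proof
  show "adjoint (A * B) = adjoint B * adjoint A" for A B
    by (rule adjointI) (simp add: adjoint)
  show "adjoint (A + B) = adjoint A + adjoint B" for A B
    by (rule adjointI) (simp add: adjoint beta_linear)
  show "adjoint (adjoint A) = A" for A
    by (rule adjointI) (metis adjoint beta_commute)
  show "(1 :: ('a, 'b) square_matrix) + 1 = 0"
    by (rule act_eqI) (simp add: vec_double del: one_add_one)
qed

lemma isometry_adjoint: "(\<And>v. Q (act X v) = Q v) \<Longrightarrow> X * adjoint X = 1"
proof (rule act_eqI, rule beta_eqI)
  fix u v assume "\<And>v. Q (act X v) = Q v"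
  then have "\<beta> (act X u) (act X v) = \<beta> u v"
    by (simp add: polar_form_def flip: act_simps(5))
  then show "\<beta> u (act (X * adjoint X) v) = \<beta> u (act 1 v)" by (simp add: adjoint)
qed

end

text \<open>The difference \<open>Q\<^sub>1 - Q\<^sub>2\<close> is additive and \<open>X\<close>-invariant on \<open>W\<close>, so its value at
  \<open>X v + \<dots> + X\<^sup>2\<^sup>s v\<close> is \<open>2 s\<close> times its value at \<open>v\<close>.\<close>

lemma invariant_forms_agree:
  fixes X :: "('a::{field,finite}, 'n::finite) square_matrix"
  assumes Q1: "quadratic_space Q1" and Q2: "quadratic_space Q2"
    and W: "vec.subspace W" "\<And>w. w \<in> W \<Longrightarrow> act X w \<in> W"
    and polar: "\<And>u w. u \<in> W \<Longrightarrow> w \<in> W \<Longrightarrow> polar_form Q1 u w = polar_form Q2 u w"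
    and inv: "\<And>v. Q1 (act X v) = Q1 v" "\<And>v. Q2 (act X v) = Q2 v"
    and w: "w \<in> W" "act (\<Sum>i=1..2 * s. X ^ i) w = w"
  shows "Q1 w = Q2 w"
proof -
  interpret Q1: quadratic_space Q1 by (rule Q1)
  interpret Q2: quadratic_space Q2 by (rule Q2)
  define D where "D v = Q1 v + Q2 v" for v
  have D_add: "D (u + v) = D u + D v" if "u \<in> W" "v \<in> W" for u v
    using polar[OF that]
    by (simp add: D_def Q1.Q_add Q2.Q_add add_ac Q1.field_double_left Q1.field_two)
  have D_sum: "(\<Sum>i\<in>I. x i) \<in> W \<and> D (\<Sum>i\<in>I. x i) = (\<Sum>i\<in>I. D (x i))"
    if "\<And>i. i \<in> I \<Longrightarrow> x i \<in> W" for I :: "nat set" and x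
    using that
  proof (induction I rule: infinite_finite_induct)
    case (insert i I)
    then show ?case using D_add by (simp add: vec.subspace_add W(1))
  qed (auto simp: vec.subspace_0 W(1) D_def)
  have Xi: "act (X ^ i) w \<in> W \<and> D (act (X ^ i) w) = D w" for i
  proof (induction i)
    case (Suc i)
    then show ?case
      using W(2) by (simp add: power_Suc2 D_def inv del: power_Suc)
  qed (simp add: w)
  have "D w = (\<Sum>i=1..2 * s. D w)"
    using D_sum[of "{1..2 * s}" "\<lambda>i. act (X ^ i) w"] Xi w(2) by (simp add: act_sum)
  then have "D w = 0" by (simp add: Q1.field_two)
  then show ?thesis by (simp add: D_def field_add_eq_0[OF Q1.char2])
qed

section \<open>Carrying one invariant form to another by an element commuting with X\<close>

context nonsingular_quadratic_space
begin

text \<open>The witness is \<open>K * g\<close>. Here \<open>g\<close> solves the norm equation on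
  \<open>W\<close>, and \<open>K\<close> is the identity on \<open>W\<close> and on \<open>U\<close>
  an isometry from \<open>Q'\<close> to \<open>Q''\<close>; since \<open>K\<close> acts first,
  \<open>Q\<close> after \<open>K * g\<close> is \<open>Q''\<close> after \<open>K\<close>, which is
  \<open>Q'\<close>.\<close>

theorem isometry_commuting:
  assumes X: "\<And>v. Q (act X v) = Q v" "X ^ (2 * s + 1) = 1"
    and h: "h * h' = 1" "h' * h = 1"
    and hX: "\<And>v. Q (act h (act X v)) = Q (act h v)"
  shows "\<exists>L. commute L X \<and> (\<forall>v. Q (act L v) = Q (act h v))"
proof -
  define S where "S = h * adjoint h"
  define f where "f = (\<Sum>i=1..2 * s. X ^ i)"
  define e where "e = 1 + f"
  let ?s = "artin_schreier_sign :: 'a \<Rightarrow> int"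
  have XX: "X * adjoint X = 1" using X(1) by (rule isometry_adjoint)
  have starX: "adjoint X * X = 1"
  proof -
    have "X ^ (2 * s) * X = 1" using X(2) by (simp add: power_commutes)
    then have "adjoint X = X ^ (2 * s)" by (rule left_right_inverse_unique[OF XX])
    then show ?thesis using X(2) by (simp add: power_commutes)
  qed
  have polar_h: "polar_form (\<lambda>v. Q (act h v)) u v = \<beta> u (act S v)" for u v
    using adjoint[of h u "act h v"] by (simp add: S_def polar_form_def)
  \<comment> \<open>Invariance under \<open>X\<close> of the polar form represented by
    \<open>S\<close>; as \<open>adjoint X\<close> inverts \<open>X\<close>, it means that
    \<open>S\<close> commutes with \<open>X\<close>.\<close>
  have "X * S * adjoint X = S"
  proof (rule act_eqI, rule beta_eqI)
    fix v u
    have "\<beta> u (act (X * S * adjoint X) v) = \<beta> (act X u) (act S (act X v))"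
      by (simp add: adjoint)
    also have "\<dots> = \<beta> u (act S v)"
      unfolding polar_h[symmetric] by (simp add: polar_form_def hX flip: act_simps(5))
    finally show "\<beta> u (act (X * S * adjoint X) v) = \<beta> u (act S v)" .
  qed
  then have "X * S * (adjoint X * X) = S * X" by (metis mult.assoc)
  then have cSX: "commute S X" by (simp add: starX commute_def)
  have starS: "adjoint S = S" by (simp add: S_def adj.star_mult)
  have "S * (adjoint h' * h') = 1"
  proof -
    have "S * (adjoint h' * h') = h * adjoint (h' * h) * h'"
      by (simp add: S_def adj.star_mult mult.assoc)
    then show ?thesis by (simp add: h)
  qed
  then obtain n where n: "S ^ n = 1" "n > 0" using finite_unit_power_eq_1 by metis
  note norm = adj.norm_eq_isometry[OF XX X(2) cSX starS n, folded f_def]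
  obtain g y where g: "g * adjoint g = S * f + e" "g * y = 1" "commute g X"
    using norm(1) unfolding e_def by metis
  have ff: "f * f = f" and Xe: "X * e = e" and star_f: "adjoint f = f"
    using norm(2-4) by (simp_all add: e_def)
  have ef: "e * f = 0" and fe: "f * e = 0"
    by (simp_all add: e_def distrib_left distrib_right ff adj.double_zero)
  have ee: "e * e = e" using fe by (simp add: e_def distrib_right)
  have star_e: "adjoint e = e" by (simp add: e_def adj.star_add star_f)
  have cf: "commute f X" "commute f S" and ce: "commute e X" "commute e S"
    unfolding e_def f_def
    by (intro commute_intros commute_sym[OF cSX]; simp)+
  have act_cf: "act X (act f v) = act f (act X v)" "act S (act f v) = act f (act S v)"
    "act X (act e v) = act e (act X v)" "act S (act e v) = act e (act S v)" for v
    using cf ce by (metis act_simps(2) commute_def)+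
  have act_idem: "act f (act f v) = act f v" "act e (act e v) = act e v"
    "act e (act f v) = 0" "act f (act e v) = 0" "act e (act X v) = act e v" for v
    using ff ee ef fe Xe by (metis act_simps(2,3))+
  have split: "act e v + act f v = v" for v
    by (simp add: e_def add.assoc vec_double)
  \<comment> \<open>\<open>U\<close> is the fixed space of \<open>X\<close> and \<open>W\<close> the
    image of \<open>X + 1\<close>.\<close>
  define U where "U = {v. act e v = v}"
  define W where "W = {v. act f v = v}"
  have subU: "vec.subspace U" and subW: "vec.subspace W"
    by (simp_all add: U_def W_def vec.subspace_def)
  have U: "act e v \<in> U" and W: "act f v \<in> W" for v
    by (simp_all add: U_def W_def act_idem)
  have Ufix: "act X u = u" "act f u = 0" "act e u = u" if "u \<in> U" for u
  proof -
    show eu: "act e u = u" using that by (simp add: U_def)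
    show "act X u = u" "act f u = 0"
      using act_cf(3)[of u] act_idem(4,5)[of u] by (simp_all add: eu)
  qed
  have Wfix: "act e w = 0" "act f w = w" if "w \<in> W" for w
  proof -
    show fw: "act f w = w" using that by (simp add: W_def)
    show "act e w = 0" using act_idem(3)[of w] by (simp add: fw)
  qed
  define Q' where "Q' v = Q (act h v)" for v
  \<comment> \<open>Its polar form agrees with that of \<open>Q'\<close> against vectors of
    \<open>W\<close> and with \<beta> against vectors of \<open>U\<close>.\<close>
  define Q'' where "Q'' v = Q (act g v)" for v
  have Q': "quadratic_space Q'" and Q'': "quadratic_space Q''"
    unfolding Q'_def Q''_def by (rule quadratic_space_act, rule quadratic_space_axioms)+
  interpret Q': quadratic_space Q' by (rule Q')
  interpret Q'': quadratic_space Q'' by (rule Q'')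
  have polar': "polar_form Q' u v = \<beta> u (act S v)" for u v
    unfolding Q'_def by (rule polar_h)
  have polar'': "polar_form Q'' u v = \<beta> u (act (S * f + e) v)" for u v
    unfolding g(1)[symmetric] Q''_def using adjoint[of g u "act g v"] by (simp add: polar_form_def)
  have agree_polar: "polar_form Q'' u w = polar_form Q' u w" if "w \<in> W" for u w
    using Wfix[OF that] by (simp add: polar' polar'' flip: act_cf)
  have polar_U: "polar_form Q'' u v = \<beta> u v" if "v \<in> U" for u v
    using Ufix[OF that] by (simp add: polar'' flip: act_cf)
  have orth: "\<beta> u w = 0" if "u \<in> U" "w \<in> W" for u w
    using adjoint[of e u w] Ufix[OF that(1)] Wfix[OF that(2)] by (simp add: star_e)
  have orth': "polar_form Q' u w = 0" if "u \<in> U" "w \<in> W" for u w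
  proof -
    have "act S w \<in> W" using Wfix[OF that(2)] act_cf(2)[of w] by (simp add: W_def)
    then show ?thesis using orth that(1) by (simp add: polar')
  qed
  have orth'': "polar_form Q'' u w = 0" if "u \<in> U" "w \<in> W" for u w
    using agree_polar orth' that by simp
  have agree: "Q'' w = Q' w" if w: "w \<in> W" for w
  proof (rule invariant_forms_agree[OF Q'' Q' subW _ _ _ _ w, where X = X and s = s])
    show "act X v \<in> W" if "v \<in> W" for v
      using that act_cf(1)[of v] by (simp add: W_def)
    show "Q'' (act X v) = Q'' v" for v
    proof -
      have "act g (act X v) = act X (act g v)"
        using g(3) by (metis act_simps(2) commute_def)
      then show ?thesis by (simp add: Q''_def X)
    qed
    show "act (\<Sum>i = 1..2 * s. X ^ i) w = w"
      using Wfix(2)[OF w] by (simp only: f_def)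
  qed (simp_all add: agree_polar Q'_def hX)
  \<comment> \<open>By orthogonality to \<open>W\<close>, a radical vector of \<open>U\<close> is
    radical in the whole space, where invertibility of \<open>h\<close> reduces the claim to
    \<beta>.\<close>
  have nd': "nondegenerate_on Q' U"
    unfolding nondegenerate_on_def
  proof (intro ballI impI)
    fix u assume u: "u \<in> U" "\<forall>v\<in>U. polar_form Q' u v = 0"
    have "polar_form Q' u v = 0" for v
      using u(2) U[of v] orth'[OF u(1) W[of v]] Q'.beta_linear(2)[of u "act e v" "act f v"]
      by (simp add: split)
    then have "\<beta> (act h u) (act h v) = 0" for v by (simp add: polar_form_def Q'_def)
    from this[of "act h' _"] have "\<beta> (act h u) v = 0" for v
      using h(2) by (metis act_simps(2,4))
    then have "act h u = 0" by (rule nondegenerate_left)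
    then show "u = 0" using h(1) by (metis act_simps(2,4,7))
  qed
  have nd'': "nondegenerate_on Q'' U"
    unfolding nondegenerate_on_def
  proof (intro ballI impI)
    fix u assume u: "u \<in> U" "\<forall>v\<in>U. polar_form Q'' u v = 0"
    have "\<beta> u v = 0" for v
      using u(2) U[of v] polar_U[OF U[of v], of u] orth[OF u(1) W[of v]]
        beta_linear(2)[of u "act e v" "act f v"]
      by (simp add: split)
    then show "u = 0" by (rule nondegenerate_left)
  qed
  have gauss_split: "gauss_sum q UNIV = gauss_sum q U * gauss_sum q W"
    if "quadratic_space q" "\<And>u w. u \<in> U \<Longrightarrow> w \<in> W \<Longrightarrow> polar_form q u w = 0" for q
  proof -
    interpret q: quadratic_space q by fact
    have "(\<Sum>(u, w)\<in>U \<times> W. ?s (q u) * ?s (q w)) = (\<Sum>v\<in>UNIV. ?s (q v))"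
    proof (rule sum.reindex_bij_witness[of _ "\<lambda>v. (act e v, act f v)" "\<lambda>(u, w). u + w"])
      fix t assume "t \<in> U \<times> W"
      then show "?s (q (case t of (u, w) \<Rightarrow> u + w)) = (case t of (u, w) \<Rightarrow> ?s (q u) * ?s (q w))"
        using that(2) by (auto simp: q.Q_add artin_schreier_sign_add[OF char2])
    qed (auto simp: U W split Ufix Wfix)
    then show ?thesis by (simp add: gauss_sum_def sum_product sum.cartesian_product)
  qed
  have gauss_act: "gauss_sum (\<lambda>v. Q (act A v)) UNIV = gauss_sum Q UNIV" if "A * B = 1" for A B
  proof -
    have "act B (act A v) = v" for v using that by (metis act_simps(2,4))
    then have "inj (act A)" by (rule inj_on_inverseI)
    then have "bij (act A)" by (simp add: bij_def finite_UNIV_inj_surj)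
    then show ?thesis unfolding gauss_sum_def by (rule sum.reindex_bij_betw)
  qed
  \<comment> \<open>Since \<open>g\<close> and \<open>h\<close> are bijective, \<open>Q'\<close> and
    \<open>Q''\<close> have the total Gauss sum of \<open>Q\<close>. It is nonzero and
    multiplicative over \<open>U\<close> and \<open>W\<close>, so the equal factors on
    \<open>W\<close> cancel.\<close>
  have "nondegenerate_on Q UNIV"
    using nonsingular by (simp add: nondegenerate_on_def nonsingular_form_def nondegenerate_def)
  then have "gauss_sum Q UNIV \<noteq> 0"
    by (intro gauss_sum_nonzero) (simp_all add: vec.subspace_UNIV)
  moreover have "gauss_sum Q UNIV = gauss_sum Q' U * gauss_sum Q' W"
    using gauss_act[OF h(1)] gauss_split[OF Q' orth'] by (simp flip: Q'_def)
  moreover have "gauss_sum Q UNIV = gauss_sum Q'' U * gauss_sum Q'' W"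
    using gauss_act[OF g(2)] gauss_split[OF Q'' orth''] by (simp flip: Q''_def)
  moreover have "gauss_sum Q'' W = gauss_sum Q' W"
    by (simp add: gauss_sum_def agree)
  ultimately have gauss_U: "gauss_sum Q' U = gauss_sum Q'' U" by simp
  obtain j where j: "Vector_Spaces.linear (*s) (*s) j" "\<And>u. u \<in> U \<Longrightarrow> j u \<in> U \<and> Q'' (j u) = Q' u"
    using isometry_if_gauss_sum_eq[OF Q' Q'' subU nd' subU nd'' refl gauss_U] by metis
  obtain J where J: "\<And>v. act J v = j v" using ex_act_eq_linear[OF j(1)] by blast
  define K where "K = e * J + f"
  have K: "act K v = j (act e v) + act f v" for v by (simp add: K_def J)
  have jU: "j (act e v) \<in> U" "Q'' (j (act e v)) = Q' (act e v)" for v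
    using j(2) U by auto
  \<comment> \<open>On \<open>U\<close>, which \<open>J\<close> preserves, \<open>X\<close> is
    trivial; on \<open>W\<close> the map \<open>K\<close> is the identity.\<close>
  have "K * X = X * K"
    by (rule act_eqI) (simp add: K act_idem act_cf Ufix(1)[OF jU(1)])
  then have "commute (K * g) X"
    using g(3) by (intro commute_mult_left) (simp_all add: commute_def)
  moreover have "Q (act (K * g) v) = Q (act h v)" for v
  proof -
    have "Q (act (K * g) v) = Q'' (act K v)" by (simp add: Q''_def)
    also have "\<dots> = Q' (act e v) + Q' (act f v)"
      by (simp add: K Q''.Q_add jU agree W orth'')
    also have "\<dots> = Q' (act e v + act f v)"
      by (simp add: Q'.Q_add orth' U W)
    finally show ?thesis by (simp add: split Q'_def)
  qed
  ultimately show ?thesis by blast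
qed

end

section \<open>Conjugacy\<close>

lemma char2_if_card_power2:
  assumes "CARD('a::{field,finite}) = 2 ^ k"
  shows "(1::'a) + 1 = 0"
proof -
  have "(of_nat CARD('a) :: 'a) = 0"
    using CHAR_dvd_CARD[where ?'a = 'a] by (simp only: of_nat_eq_0_iff_char_dvd)
  then have "(2::'a) ^ k = 0" by (simp add: assms)
  then have "(2::'a) = 0" by (rule power_eq_0_iff[THEN iffD1, THEN conjunct1])
  then show ?thesis by simp
qed

text \<open>Inverses in a subgroup are those of \<open>GL\<close>, so conjugacy becomes an
  intertwining equation, and only the range of \<open>h\<close> depends on the group.\<close>

lemma conjugate_in_subgroup:
  assumes H: "subgroup H GL" and X: "X \<in> H" "Y \<in> H"
  shows "conjugate_in (GL\<lparr>carrier := H\<rparr>) X Y \<longleftrightarrow> (\<exists>h\<in>H. h ** Y = X ** h)"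
    (is "?L \<longleftrightarrow> ?R")
proof -
  interpret group GL by (rule group_GL)
  have "Y = inv\<^bsub>GL\<^esub> h \<otimes>\<^bsub>GL\<^esub> X \<otimes>\<^bsub>GL\<^esub> h \<longleftrightarrow> h ** Y = X ** h" if "h \<in> H" for h
  proof -
    have GL: "h \<in> carrier GL" "X \<in> carrier GL" "Y \<in> carrier GL"
      using that X subgroup.mem_carrier[OF H] by auto
    have "Y = inv\<^bsub>GL\<^esub> h \<otimes>\<^bsub>GL\<^esub> X \<otimes>\<^bsub>GL\<^esub> h \<longleftrightarrow> Y = inv\<^bsub>GL\<^esub> h \<otimes>\<^bsub>GL\<^esub> (X \<otimes>\<^bsub>GL\<^esub> h)"
      using GL by (simp add: m_assoc)
    also have "\<dots> \<longleftrightarrow> h \<otimes>\<^bsub>GL\<^esub> Y = X \<otimes>\<^bsub>GL\<^esub> h"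
      using GL inv_solve_left[of Y h "X \<otimes>\<^bsub>GL\<^esub> h"] by auto
    finally show ?thesis by (simp add: GL_def)
  qed
  then show ?thesis
    unfolding conjugate_in_def using m_inv_consistent[OF H] by simp
qed

lemma matrix_of_power: "X \<in> carrier GL \<Longrightarrow> matrix_of (Square_Matrix X ^ n) = X [^]\<^bsub>GL\<^esub> n"
proof (induction n)
  case 0
  then show ?case by (simp add: one_square_matrix.rep_eq GL_def nat_pow_def)
next
  case (Suc n)
  then show ?case
    by (simp only: power_Suc2 times_square_matrix.rep_eq Square_Matrix_inverse UNIV_I
        monoid.nat_pow_Suc[OF group.is_monoid[OF group_GL]])
      (simp add: GL_def)
qed

theorem theorem4p1p14:
  fixes Q :: "'a::{field,finite} ^ 'n \<Rightarrow> 'a" and m k :: nat and \<epsilon> :: sign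
  assumes "m > 0" and "k > 0"
    and "CARD('a) = 2 ^ k" and "CARD('n) = 2 * m"
    and "quadratic_form Q" and "nonsingular_form Q" and "has_type m \<epsilon> Q"
  shows "subgroup (carrier (Oform Q)) (Spform (polar_form Q)) \<and>
    (\<forall>X\<in>carrier (Oform Q). \<forall>Y\<in>carrier (Oform Q). semisimple X \<longrightarrow> semisimple Y \<longrightarrow>
       (conjugate_in (Oform Q) X Y \<longleftrightarrow> conjugate_in (Spform (polar_form Q)) X Y) \<and>
       (conjugate_in (Spform (polar_form Q)) X Y \<longleftrightarrow> conjugate_in GL X Y)) \<and>
    (\<forall>X\<in>carrier (Oform Q). semisimple X \<longrightarrow> invertible (X + mat 1) \<longrightarrow>
       centralizer (Oform Q) X = centralizer (Spform (polar_form Q)) X)"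
proof -
  interpret nonsingular_quadratic_space Q
    by unfold_locales (use assms char2_if_card_power2 in auto)
  interpret G: group "GL :: ('a ^ 'n ^ 'n) monoid" by (rule group_GL)
  let ?O = "carrier (Oform Q)" and ?Sp = "carrier (Spform \<beta>)"
    and ?GL = "carrier (GL :: ('a ^ 'n ^ 'n) monoid)"
  have O: "Oform Q = GL\<lparr>carrier := ?O\<rparr>" and Sp: "Spform \<beta> = GL\<lparr>carrier := ?Sp\<rparr>"
    and GL: "(GL :: ('a ^ 'n ^ 'n) monoid) = GL\<lparr>carrier := ?GL\<rparr>"
    by (simp_all add: Oform_def Spform_def)
  have O_Sp: "?O \<subseteq> ?Sp"
    by (auto simp: Oform_def Spform_def polar_form_def simp flip: vector_matrix_left_distrib)
  have Sp_GL: "?Sp \<subseteq> ?GL" by (auto simp: Spform_def)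
  have sub: "subgroup ?O (Spform \<beta>)"
    using G.subgroup_incl[OF subgroup_Oform subgroup_Spform O_Sp] Sp by metis
  have conj: "conjugate_in (Oform Q) X Y \<longleftrightarrow> (\<exists>h\<in>?O. h ** Y = X ** h)"
    "conjugate_in (Spform \<beta>) X Y \<longleftrightarrow> (\<exists>h\<in>?Sp. h ** Y = X ** h)"
    "conjugate_in GL X Y \<longleftrightarrow> (\<exists>h\<in>?GL. h ** Y = X ** h)"
    if "X \<in> ?O" "Y \<in> ?O" for X Y
    using that O_Sp Sp_GL conjugate_in_subgroup[OF subgroup_Oform, of X Q Y]
      conjugate_in_subgroup[OF subgroup_Spform, of X \<beta> Y]
      conjugate_in_subgroup[OF G.subgroup_self, of X Y]
    unfolding O[symmetric] Sp[symmetric] GL[symmetric] by auto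
  have GL_to_O: "\<exists>l\<in>?O. l ** Y = X ** l"
    if X: "X \<in> ?O" "semisimple X" and Y: "Y \<in> ?O" and h: "h \<in> ?GL" "h ** Y = X ** h" for X Y h
  proof -
    define A where "A = Square_Matrix X"
    have act_A: "act A v = v v* X" for v by (simp add: act_def A_def Square_Matrix_inverse)
    have XGL: "X \<in> ?GL" using X O_Sp Sp_GL by blast
    obtain s where s: "group.ord GL X = 2 * s + 1"
      using X(2) unfolding semisimple_def by (elim oddE)
    have "A ^ (2 * s + 1) = 1"
    proof -
      have "X [^]\<^bsub>GL\<^esub> (2 * s + 1) = \<one>\<^bsub>GL\<^esub>"
        using G.pow_ord_eq_1[OF XGL] by (simp only: s)
      then have "matrix_of (A ^ (2 * s + 1)) = matrix_of 1"
        unfolding A_def matrix_of_power[OF XGL] by (simp add: one_square_matrix.rep_eq GL_def)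
      then show ?thesis by (simp only: matrix_of_inject)
    qed
    moreover obtain h' where h': "h ** h' = mat 1" "h' ** h = mat 1"
      using h(1) by (auto simp: GL_def invertible_def)
    have hh: "Square_Matrix h * Square_Matrix h' = 1" "Square_Matrix h' * Square_Matrix h = 1"
      using h' by (simp_all add: times_square_matrix.rep_eq one_square_matrix.rep_eq
          Square_Matrix_inverse flip: matrix_of_inject)
    have act_h: "act (Square_Matrix h) v = v v* h" for v
      by (simp add: act_def Square_Matrix_inverse)
    have QX: "Q (v v* X) = Q v" and QY: "Q (v v* Y) = Q v" for v
      using X Y by (auto simp: Oform_def)
    \<comment> \<open>The transported form is invariant under \<open>X\<close> because
      \<open>X ** h = h ** Y\<close> and \<open>Y\<close> preserves \<open>Q\<close>.\<close>
    have "Q (act (Square_Matrix h) (act A v)) = Q (act (Square_Matrix h) v)" for v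
      using QY[of "v v* h"] by (simp add: act_h act_A vector_matrix_mul_assoc h)
    ultimately obtain L where L: "commute L A" "\<And>v. Q (act L v) = Q (act (Square_Matrix h) v)"
      using isometry_commuting[OF _ _ hh, of A s] QX act_A by metis
    define M where "M = matrix_of L"
    have QM: "Q (v v* M) = Q (v v* h)" for v
      using L(2)[of v] by (simp add: M_def act_h) (simp add: act_def)
    have MX: "M ** X = X ** M"
      using L(1) by (simp add: commute_def M_def A_def times_square_matrix.rep_eq
          Square_Matrix_inverse flip: matrix_of_inject)
    \<comment> \<open>\<open>M\<close> and \<open>h\<close> pull \<beta> back to the same form, so
      by nondegeneracy the image under \<open>M\<close> determines the image under \<open>h\<close>,
      and \<open>h\<close> is invertible.\<close>
    have "inj (\<lambda>v. v v* M)"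
    proof (rule injI)
      fix u v assume uv: "u v* M = v v* M"
      have polar: "\<beta> (u v* M) (w v* M) = \<beta> (u v* h) (w v* h)" for u w
        by (simp add: polar_form_def QM flip: vector_matrix_left_distrib)
      have "\<beta> (w v* h) (u v* h) = \<beta> (w v* h) (v v* h)" for w
        by (metis uv polar)
      from this[of "_ v* h'"] have "\<beta> w (u v* h) = \<beta> w (v v* h)" for w
        by (simp add: vector_matrix_mul_assoc h')
      then have "u v* h = v v* h" by (rule beta_eqI)
      then have "u v* h v* h' = v v* h v* h'" by simp
      then show "u = v" by (simp add: vector_matrix_mul_assoc h')
    qed
    then have "inj ((*v) (transpose M))" by (simp add: inj_def transpose_matrix_vector)
    then have "\<exists>B. M ** B = mat 1"
      unfolding matrix_left_invertible_injective[symmetric] left_invertible_transpose .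
    then have "\<exists>B. M ** B = mat 1 \<and> B ** M = mat 1"
      using matrix_left_right_inverse by blast
    then obtain M' where M': "M ** M' = mat 1" "M' ** M = mat 1"
      by blast
    have "M' ** h \<in> ?O"
    proof -
      have "invertible (M' ** h)"
        using M' h by (intro invertible_mult) (auto simp: GL_def invertible_def)
      moreover have "Q (v v* (M' ** h)) = Q v" for v
        using QM[of "v v* M'"] by (simp add: M' vector_matrix_mul_assoc)
      ultimately show ?thesis by (simp add: Oform_def GL_def)
    qed
    moreover have "(M' ** h) ** Y = X ** (M' ** h)"
    proof -
      have "M' ** X = M' ** X ** (M ** M')" by (simp add: M')
      also have "\<dots> = (M' ** M) ** X ** M'" by (metis MX matrix_mul_assoc)
      finally have "M' ** X = X ** M'" by (simp add: M')
      then show ?thesis by (metis h(2) matrix_mul_assoc)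
    qed
    ultimately show ?thesis by blast
  qed
  have cent: "centralizer (Oform Q) X = centralizer (Spform \<beta>) X"
    if X: "X \<in> ?O" "invertible (X + mat 1)" for X
  proof -
    have "h \<in> ?O" if h: "h \<in> ?Sp" "h ** X = X ** h" for h
    proof -
      \<comment> \<open>\<open>D\<close> is additive because \<open>h\<close> preserves \<beta>, and
        invariant under \<open>X\<close> because \<open>h\<close> commutes with \<open>X\<close>.
        Every vector has the form \<open>u v* X + u\<close>, since \<open>X + mat 1\<close> is
        invertible, and there \<open>D\<close> takes the value \<open>D u + D u = 0\<close>.\<close>
      define D where "D v = Q (v v* h) + Q v" for v
      have QX: "Q (v v* X) = Q v" for v using X by (simp add: Oform_def)
      have D_add: "D (u + v) = D u + D v" for u v
        using h(1) by (simp add: D_def Spform_def vector_matrix_left_distrib Q_add add_ac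
            field_double_left field_two)
      have DX: "D (v v* X) = D v" for v
        using QX[of "v v* h"] QX[of v] h(2)
        by (simp add: D_def vector_matrix_mul_assoc)
      obtain Z where Z: "Z ** (X + mat 1) = mat 1" using X(2) by (auto simp: invertible_def)
      have "D v = 0" for v
      proof -
        define u where "u = v v* Z"
        have "v = u v* X + u"
          using Z by (metis u_def vector_matrix_mul_assoc vector_matrix_mul_rid
              vector_matrix_mult_add_rdistrib)
        then show ?thesis by (simp add: D_add DX field_two)
      qed
      then have "Q (v v* h) = Q v" for v
        by (simp add: D_def field_add_eq_0[OF char2])
      then show ?thesis using h(1) Sp_GL by (auto simp: Oform_def)
    qed
    then show ?thesis
      using O_Sp by (auto simp: centralizer_def Oform_def Spform_def GL_def)
  qed
  have "(conjugate_in (Oform Q) X Y \<longleftrightarrow> conjugate_in (Spform \<beta>) X Y) \<and>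
      (conjugate_in (Spform \<beta>) X Y \<longleftrightarrow> conjugate_in GL X Y)"
    if XY: "X \<in> ?O" "Y \<in> ?O" "semisimple X" for X Y
  proof -
    have "conjugate_in (Oform Q) X Y" if "conjugate_in GL X Y"
      using that GL_to_O[OF XY(1,3,2)] unfolding conj[OF XY(1,2)] by metis
    moreover have "conjugate_in (Spform \<beta>) X Y" if "conjugate_in (Oform Q) X Y"
      using that O_Sp unfolding conj[OF XY(1,2)] by (meson subsetD)
    moreover have "conjugate_in GL X Y" if "conjugate_in (Spform \<beta>) X Y"
      using that Sp_GL unfolding conj[OF XY(1,2)] by (meson subsetD)
    ultimately show ?thesis by metis
  qed
  then show ?thesis using sub cent by simp
qed

end
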